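(* For every $d\in[0,1)$ and every irrational $\xi_0\in\mathbb{R}$, there is an $F_\sigma$ subgroup $A$ of $(\mathbb{R},+)$ such that $$\dim_{\mathrm H} A=d,\qquad A+\xi_0 A=\mathbb{R},\qquad \dim_{\mathrm H}(A+\xi A)=1\quad\text{for Lebesgue-almost every }\xi\in\mathbb{R}.$$
   Context: $\dim_{\mathrm H}$ denotes Hausdorff dimension with respect to the Euclidean metric. For $A\subseteq\mathbb{R}$ and $\xi\in\mathbb{R}$, $A+\xi A=\{a+\xi b: a,b\in A\}$. $F_\sigma$ means a countable union of closed subsets of $\mathbb{R}$. *)

theory Defs
  imports "HOL-Analysis.Analysis" "HOL-Library.Set_Algebras" "HOL-Algebra.Group"
begin

text \<open>
  The convention for the exponent 0 is $|U|^0 = 1$ for nonempty \<open>U\<close> and 0 for the empty set;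
  \<open>0 powr 0 = 0\<close> would instead ignore singletons.
\<close>

definition diam_power :: "real \<Rightarrow> 'a::metric_space set \<Rightarrow> ennreal" where
  "diam_power s U =
     (if U = {} then 0 else if s = 0 then 1 else ennreal (diameter U powr s))"

text \<open>
  Boundedness is required of covering sets because \<^const>\<open>diameter\<close> is a real number, which is
  meaningless for unbounded sets. Finite covers are included, padded by empty sets.
\<close>

definition hausdorff_content :: "real \<Rightarrow> real \<Rightarrow> 'a::metric_space set \<Rightarrow> ennreal" where
  "hausdorff_content s \<delta> A =
     (INF U \<in> {U :: nat \<Rightarrow> 'a set. (\<forall>i. bounded (U i) \<and> diameter (U i) \<le> \<delta>) \<and> A \<subseteq> (\<Union>i. U i)}.
        \<Sum>i. diam_power s (U i))"

definition hausdorff_measure :: "real \<Rightarrow> 'a::metric_space set \<Rightarrow> ennreal" where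
  "hausdorff_measure s A = (SUP \<delta>\<in>{0<..}. hausdorff_content s \<delta> A)"

text \<open>
  Taking values in \<^typ>\<open>ennreal\<close> makes the dimension infinite, rather than arbitrary, when no
  exponent is admissible.
\<close>

definition hausdorff_dim :: "'a::metric_space set \<Rightarrow> ennreal" where
  "hausdorff_dim A = (INF s \<in> {s. 0 \<le> s \<and> hausdorff_measure s A = 0}. ennreal s)"

abbreviation real_add_group :: "real monoid" where
  "real_add_group \<equiv> \<lparr>carrier = UNIV, mult = (+), one = 0\<rparr>"

lemma group_real_add_group: "group real_add_group"
proof (rule groupI)
  fix x
  show "\<exists>y\<in>carrier real_add_group. y \<otimes>\<^bsub>real_add_group\<^esub> x = \<one>\<^bsub>real_add_group\<^esub>"
    by (auto intro: exI[of _ "- x"])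
qed auto

end

theory Submission
  imports Defs "HOL-Real_Asymp.Real_Asymp"
begin

text \<open>
  Write \<open>\<xi>\<close> for the given irrational number. Suppose that \<open>b\<close> is a real function on \<open>[0, 1)\<close> and
  put \<open>a(x) = x - \<xi> b(x)\<close>. Every group \<open>A\<close> that contains all \<open>a(x)\<close> and \<open>b(x)\<close> satisfies
  \<open>A + \<xi> A = \<real>\<close>, because \<open>a(x) + \<xi> b(x) = x\<close>. The point is to choose \<open>b\<close> so that the group generated by
  these numbers has dimension 0. Its elements are sums of terms
  \<open>m a(x) + n b(x) = m x + (n - m \<xi>) b(x)\<close> with integers \<open>m\<close> and \<open>n\<close>. If \<open>b\<close> is, up to a tiny
  error, linear with slope \<open>m / (m \<xi> - n)\<close> on an interval, then such a term is almost
  constant there. Since \<open>\<xi>\<close> is irrational, this slope exists for all \<open>(m, n) \<noteq> (0, 0)\<close>.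

  So \<open>b\<close> is built in stages. At stage \<open>k\<close> the unit interval is cut into pieces, and \<open>b\<close> gets a slope
  on each of them. The pieces of the next stage are so much shorter that the number of pieces of
  stage \<open>k\<close> is negligible against every negative power of the new length. The slopes of
  stage \<open>k\<close> are read off a finite table that assigns pairs \<open>(m, n)\<close> to disjoint intervals, and every
  table serves infinitely many stages. Given a sum of \<open>N\<close> terms, equal points can be merged, and distinct
  points are separated by some table, so that infinitely often all \<open>N\<close> terms are almost
  constant on each piece at the same time. The sums then lie in few tiny intervals, and
  their dimension is 0 (\<open>coverable_table_sums\<close>). The function \<open>b\<close> jumps at the end points of the pieces, so
  it is defined on the compact space of digit sequences instead; there it is continuous,
  and the generated group is a countable union of compact sets (\<open>compact_combinations\<close>).

  To reach dimension \<open>d\<close>, a group of dimension \<open>d\<close> is added that is a countable union of closed sets whose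
  covering numbers at the relevant scales \<open>r\<close> are at most \<open>r powr (- d)\<close>, up to
  a factor that grows more slowly than every negative power of \<open>r\<close>; adding such a set does not raise the dimension above \<open>d\<close>
  (\<open>hausdorff_measure_table_sums_layer\<close>).

  Finally \<open>A + \<eta> A\<close> contains all numbers \<open>a(x) + \<eta> b(x) = x + (\<eta> - \<xi>) b(x)\<close>. For two points \<open>x\<close> and \<open>y\<close>, the
  images under this map are within distance \<open>r\<close> only for parameters \<open>\<eta>\<close> whose measure, in a bounded interval,
  is \<open>O(r / \<bar>x - y\<bar>)\<close>, whatever \<open>b\<close> is. Hence
  for almost every \<open>\<eta>\<close> the image of Lebesgue measure has finite energy of every order
  \<open>s < 1\<close>, and the image has dimension 1 (\<open>AE_hausdorff_measure_pencil_pos\<close>).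
\<close>

section \<open>Hausdorff measure and covering numbers\<close>

lemma hausdorff_content_mono:
  assumes "A \<subseteq> B"
  shows "hausdorff_content s \<delta> A \<le> hausdorff_content s \<delta> B"
  unfolding hausdorff_content_def using assms by (intro INF_superset_mono) auto

lemma hausdorff_measure_mono:
  assumes "A \<subseteq> B"
  shows "hausdorff_measure s A \<le> hausdorff_measure s B"
  unfolding hausdorff_measure_def by (intro SUP_mono') (use hausdorff_content_mono[OF assms] in auto)

text \<open>
  Sets of diameter at most 1 have smaller powers for larger exponents, and covers by such sets
  determine the measure.
\<close>

lemma hausdorff_measure_antimono_exponent:
  assumes "0 \<le> s" "s \<le> t"
  shows "hausdorff_measure t A \<le> hausdorff_measure s A"
  unfolding hausdorff_measure_def
proof (rule SUP_least)
  fix \<delta> :: real assume "\<delta> \<in> {0<..}"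
  then have m: "min \<delta> 1 \<in> {0<..}" by auto
  have "hausdorff_content t \<delta> A \<le> hausdorff_content s (min \<delta> 1) A"
    unfolding hausdorff_content_def
  proof (rule INF_mono)
    fix U :: "nat \<Rightarrow> 'a set"
    assume U: "U \<in> {U. (\<forall>i. bounded (U i) \<and> diameter (U i) \<le> min \<delta> 1) \<and> A \<subseteq> (\<Union>i. U i)}"
    have "diam_power t (U i) \<le> diam_power s (U i)" for i
    proof -
      have "0 \<le> diameter (U i)" "diameter (U i) \<le> 1" using U by (auto intro: diameter_ge_0)
      then have "diameter (U i) powr t \<le> diameter (U i) powr s" if "s > 0"
        using powr_mono'[of s t "diameter (U i)"] assms by auto
      moreover have "diameter (U i) powr t \<le> 1"
        using \<open>0 \<le> diameter (U i)\<close> \<open>diameter (U i) \<le> 1\<close> assms by (intro powr_le1) auto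
      ultimately show ?thesis using assms by (auto simp: diam_power_def intro!: ennreal_leI)
    qed
    then have "(\<Sum>i. diam_power t (U i)) \<le> (\<Sum>i. diam_power s (U i))"
      by (intro suminf_le) auto
    then show "\<exists>V\<in>{U. (\<forall>i. bounded (U i) \<and> diameter (U i) \<le> \<delta>) \<and> A \<subseteq> (\<Union>i. U i)}.
        (\<Sum>i. diam_power t (V i)) \<le> (\<Sum>i. diam_power s (U i))"
      using U by (intro bexI[of _ U]) auto
  qed
  also have "\<dots> \<le> (SUP \<delta>\<in>{0<..}. hausdorff_content s \<delta> A)" by (rule SUP_upper[OF m])
  finally show "hausdorff_content t \<delta> A \<le> (SUP \<delta>\<in>{0<..}. hausdorff_content s \<delta> A)" .
qed

lemma hausdorff_measure_eq_0I:
  assumes "\<And>e \<delta>. e > 0 \<Longrightarrow> \<delta> > 0 \<Longrightarrow> \<exists>U :: nat \<Rightarrow> 'a::metric_space set.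
    (\<forall>i. bounded (U i) \<and> diameter (U i) \<le> \<delta>) \<and> A \<subseteq> (\<Union>i. U i) \<and>
    (\<Sum>i. diam_power s (U i)) \<le> ennreal e"
  shows "hausdorff_measure s A = 0"
proof -
  have "hausdorff_content s \<delta> A \<le> 0" if "\<delta> > 0" for \<delta>
  proof (rule ennreal_le_epsilon)
    fix e :: real assume "e > 0"
    from assms[OF this that] obtain U :: "nat \<Rightarrow> 'a set"
      where U: "\<forall>i. bounded (U i) \<and> diameter (U i) \<le> \<delta>" "A \<subseteq> (\<Union>i. U i)"
        "(\<Sum>i. diam_power s (U i)) \<le> ennreal e" by blast
    then show "hausdorff_content s \<delta> A \<le> 0 + ennreal e"
      unfolding hausdorff_content_def by (auto intro!: INF_lower2[of U])
  qed
  then show ?thesis unfolding hausdorff_measure_def by (intro antisym SUP_least) auto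
qed

lemma hausdorff_measure_0_cover:
  fixes A :: "'a::metric_space set"
  assumes "hausdorff_measure s A = 0" "e > 0" "\<delta> > 0"
  obtains U where "\<And>i. bounded (U i)" "\<And>i. diameter (U i) \<le> \<delta>" "A \<subseteq> (\<Union>i. U i)"
    "(\<Sum>i::nat. diam_power s (U i)) < ennreal e"
proof -
  have "hausdorff_content s \<delta> A \<le> hausdorff_measure s A"
    unfolding hausdorff_measure_def using assms by (intro SUP_upper) auto
  then have "hausdorff_content s \<delta> A < ennreal e" using assms by auto
  then show ?thesis using that unfolding hausdorff_content_def INF_less_iff by auto
qed

lemma hausdorff_measure_0_Union:
  fixes A :: "nat \<Rightarrow> 'a::metric_space set"
  assumes "\<And>n. hausdorff_measure s (A n) = 0"
  shows "hausdorff_measure s (\<Union>n. A n) = 0"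
proof (rule hausdorff_measure_eq_0I)
  fix e \<delta> :: real assume "e > 0" "\<delta> > 0"
  have "\<exists>U. (\<forall>i. bounded (U i) \<and> diameter (U i) \<le> \<delta>) \<and> A n \<subseteq> (\<Union>i. U i) \<and>
      (\<Sum>i::nat. diam_power s (U i)) < ennreal (e * (1/2) ^ Suc n)" for n
    using hausdorff_measure_0_cover[OF assms, of "e * (1/2) ^ Suc n" \<delta> n] \<open>e > 0\<close> \<open>\<delta> > 0\<close>
    by (metis zero_less_mult_iff half_gt_zero zero_less_one zero_less_power)
  then obtain U where U: "\<And>n i. bounded (U n i) \<and> diameter (U n i) \<le> \<delta>"
    "\<And>n. A n \<subseteq> (\<Union>i. U n i)" "\<And>n. (\<Sum>i::nat. diam_power s (U n i)) < ennreal (e * (1/2) ^ Suc n)"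
    by metis
  define V where "V = (\<lambda>k. case prod_decode k of (n, i) \<Rightarrow> U n i)"
  have V: "bounded (V i) \<and> diameter (V i) \<le> \<delta>" for i
    using U(1) by (auto simp: V_def split: prod.splits)
  have "(\<Sum>k. diam_power s (V k)) = (\<Sum>n. \<Sum>i. diam_power s (U n i))"
    using suminf_ennreal_2dimen[where f = "\<lambda>(n, i). diam_power s (U n i)"
      and g = "\<lambda>n. \<Sum>i. diam_power s (U n i)"]
    by (simp add: V_def comp_def split_def)
  also have "\<dots> \<le> (\<Sum>n. ennreal (e * (1/2) ^ Suc n))"
    using U(3) by (intro suminf_le) (auto intro: less_imp_le)
  also have "\<dots> = ennreal e"
    using sums_mult[OF power_half_series, of e] \<open>e > 0\<close> by (intro suminf_ennreal_eq) auto
  finally have "(\<Sum>k. diam_power s (V k)) \<le> ennreal e" .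
  moreover have "(\<Union>n. A n) \<subseteq> (\<Union>k. V k)"
  proof
    fix x assume "x \<in> (\<Union>n. A n)"
    then obtain n i where "x \<in> U n i" using U(2) by blast
    then have "x \<in> V (prod_encode (n, i))" by (simp add: V_def)
    then show "x \<in> (\<Union>k. V k)" by blast
  qed
  ultimately show "\<exists>U. (\<forall>i. bounded (U i) \<and> diameter (U i) \<le> \<delta>) \<and> (\<Union>n. A n) \<subseteq> (\<Union>i. U i) \<and>
      (\<Sum>i::nat. diam_power s (U i)) \<le> ennreal e"
    using V by blast
qed

lemma hausdorff_measure_0_countable_Union:
  fixes A :: "'i \<Rightarrow> 'a::metric_space set"
  assumes "countable I" "\<And>i. i \<in> I \<Longrightarrow> hausdorff_measure s (A i) = 0"
  shows "hausdorff_measure s (\<Union>i\<in>I. A i) = 0"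
proof (cases "I = {}")
  case True
  have "hausdorff_measure s ({} :: 'a set) = 0"
    by (rule hausdorff_measure_eq_0I, rule exI[of _ "\<lambda>_. {}"]) (auto simp: diam_power_def)
  then show ?thesis using True by simp
next
  case False
  have "(\<Union>i\<in>I. A i) = (\<Union>n. A (from_nat_into I n))"
    using range_from_nat_into[OF False assms(1)] by (metis image_image)
  then show ?thesis
    using hausdorff_measure_0_Union[of s "\<lambda>n. A (from_nat_into I n)"] assms(2) from_nat_into[OF False]
    by simp
qed

lemma hausdorff_dim_mono: "A \<subseteq> B \<Longrightarrow> hausdorff_dim A \<le> hausdorff_dim B"
  unfolding hausdorff_dim_def
  by (intro INF_superset_mono) (auto dest: hausdorff_measure_mono intro: antisym simp: le_zero_eq[symmetric] simp del: le_zero_eq intro: order_trans)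

lemma hausdorff_dim_le:
  assumes "0 \<le> d" "\<And>s. s > d \<Longrightarrow> hausdorff_measure s A = 0"
  shows "hausdorff_dim A \<le> ennreal d"
proof (rule ennreal_le_epsilon)
  fix e :: real assume "e > 0"
  then have "hausdorff_dim A \<le> ennreal (d + e)"
    unfolding hausdorff_dim_def using assms by (intro INF_lower) auto
  then show "hausdorff_dim A \<le> ennreal d + ennreal e" using assms \<open>e > 0\<close> by (simp add: ennreal_plus)
qed

text \<open>
  Nonzero measure is asked for only along exponents that approach \<open>d\<close>; this suits
  almost-everywhere statements, which can hold simultaneously for countably many exponents.
\<close>

lemma hausdorff_dim_ge:
  assumes "\<And>t. t < d \<Longrightarrow> \<exists>s\<ge>t. hausdorff_measure s A \<noteq> 0"
  shows "ennreal d \<le> hausdorff_dim A"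
  unfolding hausdorff_dim_def
proof (rule INF_greatest)
  fix t assume "t \<in> {s. 0 \<le> s \<and> hausdorff_measure s A = 0}"
  then have t: "0 \<le> t" "hausdorff_measure t A = 0" by auto
  have "d \<le> t"
  proof (rule ccontr)
    assume "\<not> d \<le> t"
    then obtain s where "s \<ge> t" "hausdorff_measure s A \<noteq> 0" using assms[of t] by auto
    then show False using hausdorff_measure_antimono_exponent[OF t(1), of s A] t by auto
  qed
  then show "ennreal d \<le> ennreal t" by (rule ennreal_leI)
qed

definition coverable :: "real \<Rightarrow> real \<Rightarrow> real set \<Rightarrow> bool" where
  "coverable N r A \<longleftrightarrow> (\<exists>P. finite P \<and> real (card P) \<le> N \<and> A \<subseteq> (\<Union>p\<in>P. cball p r))"

lemma coverableI:
  "finite P \<Longrightarrow> real (card P) \<le> N \<Longrightarrow> A \<subseteq> (\<Union>p\<in>P. cball p r) \<Longrightarrow> coverable N r A"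
  unfolding coverable_def by blast

lemma coverable_mono: "coverable N r A \<Longrightarrow> N \<le> N' \<Longrightarrow> r \<le> r' \<Longrightarrow> coverable N' r' A"
  unfolding coverable_def by (force simp: subset_iff)

lemma coverable_plus:
  assumes "coverable N r A" "coverable N' r' B"
  shows "coverable (N * N') (r + r') (A + B)"
proof -
  obtain P Q where PQ: "finite P" "real (card P) \<le> N" "A \<subseteq> (\<Union>p\<in>P. cball p r)"
    "finite Q" "real (card Q) \<le> N'" "B \<subseteq> (\<Union>p\<in>Q. cball p r')"
    using assms unfolding coverable_def by blast
  let ?R = "(\<lambda>(p, q). p + q) ` (P \<times> Q)"
  have "card ?R \<le> card P * card Q"
    using card_image_le[of "P \<times> Q" "\<lambda>(p, q). p + q"] PQ by (simp add: card_cartesian_product)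
  then have "real (card ?R) \<le> real (card P) * real (card Q)"
    by (metis of_nat_mono of_nat_mult)
  also have "\<dots> \<le> N * N'" using PQ by (intro mult_mono) (auto intro: order_trans[of 0 "real (card P)"])
  finally have c: "real (card ?R) \<le> N * N'" .
  have "A + B \<subseteq> (\<Union>p\<in>?R. cball p (r + r'))"
  proof
    fix x assume "x \<in> A + B"
    then obtain a b where ab: "x = a + b" "a \<in> A" "b \<in> B" by (auto simp: set_plus_def)
    obtain p where p: "p \<in> P" "dist p a \<le> r" using ab PQ(3) by auto
    obtain q where q: "q \<in> Q" "dist q b \<le> r'" using ab PQ(6) by auto
    have "dist (p + q) x \<le> r + r'" using p q ab(1) by (simp add: dist_real_def)
    then show "x \<in> (\<Union>p\<in>?R. cball p (r + r'))" using p q by (auto intro!: bexI[of _ "(p, q)"])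
  qed
  then show ?thesis using c PQ by (intro coverableI[of ?R]) auto
qed

text \<open>
  Efficient covers at a sequence of scales suffice. The covering numbers at the scales in between may be
  large, which is how \<open>A\<close> can have small dimension although \<open>A + \<xi> A = \<real>\<close>.
\<close>

lemma hausdorff_measure_0_coverable:
  assumes "s > 0" and cov: "\<And>e. e > 0 \<Longrightarrow> \<exists>N r. coverable N r A \<and> 0 \<le> r \<and> r \<le> e \<and> N * (2 * r) powr s \<le> e"
  shows "hausdorff_measure s A = 0"
proof (rule hausdorff_measure_eq_0I)
  fix e \<delta> :: real assume e: "e > 0" "\<delta> > 0"
  define e' where "e' = min e (\<delta>/2)"
  obtain N r where Nr: "coverable N r A" "0 \<le> r" "r \<le> e'" "N * (2 * r) powr s \<le> e'"
    using cov[of e'] e by (auto simp: e'_def)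
  then obtain P where P: "finite P" "real (card P) \<le> N" "A \<subseteq> (\<Union>p\<in>P. cball p r)"
    unfolding coverable_def by blast
  obtain h where h: "bij_betw h {0..<card P} P" using ex_bij_betw_nat_finite[OF P(1)] by blast
  define U where "U i = (if i < card P then cball (h i) r else {})" for i
  have "A \<subseteq> (\<Union>i. U i)"
  proof
    fix x assume "x \<in> A"
    then obtain p where "p \<in> P" "x \<in> cball p r" using P by blast
    moreover obtain i where "i < card P" "h i = p" using h \<open>p \<in> P\<close> unfolding bij_betw_def by (metis atLeastLessThan_iff imageE)
    ultimately show "x \<in> (\<Union>i. U i)" by (auto simp: U_def intro!: exI[of _ i])
  qed
  moreover have "bounded (U i) \<and> diameter (U i) \<le> \<delta>" for i
    using Nr e by (auto simp: U_def diameter_cball e'_def)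
  moreover have "(\<Sum>i. diam_power s (U i)) \<le> ennreal e"
  proof -
    have "(\<Sum>i. diam_power s (U i)) = (\<Sum>i<card P. diam_power s (U i))"
      by (rule suminf_finite) (auto simp: U_def diam_power_def)
    also have "\<dots> \<le> (\<Sum>i<card P. ennreal ((2 * r) powr s))"
      using Nr \<open>s > 0\<close> by (intro sum_mono) (auto simp: U_def diam_power_def diameter_cball)
    also have "\<dots> = ennreal (real (card P) * (2 * r) powr s)"
      by (simp add: ennreal_mult' ennreal_of_nat_eq_real_of_nat)
    also have "\<dots> \<le> ennreal e"
      using Nr P mult_right_mono[OF P(2), of "(2 * r) powr s"] by (intro ennreal_leI) (auto simp: e'_def)
    finally show ?thesis .
  qed
  ultimately show "\<exists>U. (\<forall>i. bounded (U i) \<and> diameter (U i) \<le> \<delta>) \<and> A \<subseteq> (\<Union>i. U i) \<and>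
      (\<Sum>i::nat. diam_power s (U i)) \<le> ennreal e"
    by blast
qed

lemma hausdorff_dim_real_le_1: "hausdorff_dim (A :: real set) \<le> 1"
proof -
  have "hausdorff_measure s (UNIV :: real set) = 0" if "s > 1" for s
  proof -
    have "hausdorff_measure s {of_int k .. of_int k + 1 :: real} = 0" for k :: int
    proof (rule hausdorff_measure_0_coverable)
      fix e :: real assume "e > 0"
      have l: "((\<lambda>n. (real n + 1) * (2 * (1 / (real n + 1))) powr s) \<longlongrightarrow> 0) sequentially"
        "((\<lambda>n. 1 / (real n + 1)) \<longlongrightarrow> 0) sequentially"
        using \<open>s > 1\<close> by real_asymp+
      have "\<forall>\<^sub>F n in sequentially. (real n + 1) * (2 * (1 / (real n + 1))) powr s < e \<and> 1 / (real n + 1) < e"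
        using order_tendstoD(2)[OF l(1) \<open>e > 0\<close>] order_tendstoD(2)[OF l(2) \<open>e > 0\<close>]
        by (rule eventually_conj)
      then obtain n :: nat where n: "(real n + 1) * (2 * (1 / (real n + 1))) powr s < e" "1 / (real n + 1) < e"
        by (auto simp: eventually_sequentially)
      let ?P = "(\<lambda>i. of_int k + real i / (real n + 1)) ` {..n}"
      have "{of_int k .. of_int k + 1 :: real} \<subseteq> (\<Union>p\<in>?P. cball p (1 / (real n + 1)))"
      proof
        fix x :: real assume x: "x \<in> {of_int k .. of_int k + 1}"
        define i where "i = min n (nat \<lfloor>(x - k) * (real n + 1)\<rfloor>)"
        have y: "0 \<le> (x - k) * (real n + 1)" "(x - k) * (real n + 1) \<le> real n + 1"
          using x mult_right_mono[of "x - k" 1 "real n + 1"] by auto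
        have "real i \<le> (x - k) * (real n + 1)" "(x - k) * (real n + 1) \<le> real i + 1"
          unfolding i_def using y by linarith+
        then have "\<bar>(x - k) * (real n + 1) - real i\<bar> \<le> 1" by (simp add: abs_le_iff)
        moreover have "(x - k) - real i / (real n + 1) = ((x - k) * (real n + 1) - real i) / (real n + 1)"
          by (simp add: diff_divide_distrib)
        ultimately have "\<bar>(x - k) - real i / (real n + 1)\<bar> \<le> 1 / (real n + 1)"
          by (simp add: abs_divide divide_right_mono)
        then show "x \<in> (\<Union>p\<in>?P. cball p (1 / (real n + 1)))"
          by (intro UN_I[of "of_int k + real i / (real n + 1)"]) (auto simp: i_def dist_real_def)
      qed
      moreover have "card ?P \<le> n + 1" using card_image_le[of "{..n}"] by simp
      ultimately have "coverable (real n + 1) (1 / (real n + 1)) {of_int k .. of_int k + 1 :: real}"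
        by (intro coverableI[of ?P]) auto
      then show "\<exists>N r. coverable N r {of_int k .. of_int k + 1 :: real} \<and> 0 \<le> r \<and> r \<le> e \<and> N * (2 * r) powr s \<le> e"
        using n by (intro exI conjI) (auto intro: less_imp_le)
    qed (use that in auto)
    then have "hausdorff_measure s (\<Union>k::int. {of_int k .. of_int k + 1 :: real}) = 0"
      by (intro hausdorff_measure_0_countable_Union) auto
    moreover have "(\<Union>k::int. {of_int k .. of_int k + 1 :: real}) = UNIV"
    proof -
      have "x \<in> {of_int \<lfloor>x\<rfloor> .. of_int \<lfloor>x\<rfloor> + 1}" for x :: real by simp
      then show ?thesis by blast
    qed
    ultimately show ?thesis by simp
  qed
  then have "hausdorff_dim (UNIV :: real set) \<le> ennreal 1" by (intro hausdorff_dim_le) auto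
  then show ?thesis using hausdorff_dim_mono[of A UNIV] by auto
qed

section \<open>Lower bounds for Hausdorff measure\<close>

text \<open>
  The inverse of \<open>f\<close> is Hoelder continuous of exponent \<open>s\<close>. A cover of the image thus yields a cover
  of \<open>[0, 1)\<close> by intervals of length proportional to the powers of the diameters, and their total
  length is at least 1.
\<close>

lemma hausdorff_measure_pos_Holder_inverse:
  fixes f :: "real \<Rightarrow> real"
  assumes "0 \<le> s" "C > 0"
    and H: "\<And>x y. x \<in> {0..<1} \<Longrightarrow> y \<in> {0..<1} \<Longrightarrow> x < y \<Longrightarrow> f x \<noteq> f y \<and> \<bar>x - y\<bar> \<le> C * \<bar>f x - f y\<bar> powr s"
  shows "hausdorff_measure s (f ` {0..<1}) \<noteq> 0"
proof
  assume "hausdorff_measure s (f ` {0..<1}) = 0"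
  then obtain U where U: "\<And>i. bounded (U i)" "\<And>i. diameter (U i) \<le> 1" "f ` {0..<1} \<subseteq> (\<Union>i. U i)"
    "(\<Sum>i::nat. diam_power s (U i)) < ennreal (1 / (4 * C))"
    using hausdorff_measure_0_cover[of s "f ` {0..<1}" "1 / (4 * C)" 1] \<open>C > 0\<close> by auto
  define V where "V i = {x \<in> {0..<1}. f x \<in> U i}" for i
  \<comment> \<open>The intervals are centred at an arbitrary point of the preimage, since the preimage itself need not be measurable.\<close>
  define W where "W i = (if V i = {} then {} else cball (SOME x. x \<in> V i) (C * (if s = 0 then 1 else diameter (U i) powr s)))" for i
  have W: "V i \<subseteq> W i" for i
  proof (cases "V i = {}")
    case False
    define c where "c = (SOME x. x \<in> V i)"
    have c: "c \<in> V i" unfolding c_def using False by (simp add: some_in_eq)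
    have "\<bar>c - x\<bar> \<le> C * (if s = 0 then 1 else diameter (U i) powr s)" if x: "x \<in> V i" for x
    proof (cases "x = c")
      case False
      have d: "\<bar>f c - f x\<bar> \<le> diameter (U i)"
        using diameter_bounded_bound[OF U(1)[of i], of "f c" "f x"] x c by (auto simp: V_def dist_real_def)
      have "f c \<noteq> f x \<and> \<bar>c - x\<bar> \<le> C * \<bar>f c - f x\<bar> powr s"
        using H[of c x] H[of x c] x c False by (cases "c < x") (auto simp: V_def abs_minus_commute)
      moreover have "\<bar>f c - f x\<bar> powr s \<le> diameter (U i) powr s"
        using d \<open>0 \<le> s\<close> by (intro powr_mono2) auto
      ultimately show ?thesis using \<open>C > 0\<close>
        by (auto intro: order_trans[OF _ mult_left_mono[of _ _ C]])
    qed (use \<open>C > 0\<close> in auto)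
    then show ?thesis using False by (auto simp: W_def c_def dist_real_def)
  qed (auto simp: W_def)
  have e: "emeasure lborel (W i) \<le> ennreal (2 * C) * diam_power s (U i)" for i
  proof (cases "V i = {}")
    case False
    then have "U i \<noteq> {}" by (auto simp: V_def)
    let ?r = "C * (if s = 0 then 1 else diameter (U i) powr s)"
    have r: "?r \<ge> 0" using \<open>C > 0\<close> by auto
    have "emeasure lborel (W i) = ennreal (2 * ?r)"
      using False r by (simp add: W_def cball_eq_atLeastAtMost)
    also have "\<dots> = ennreal (2 * C) * diam_power s (U i)"
      using \<open>U i \<noteq> {}\<close> \<open>C > 0\<close> by (auto simp: diam_power_def ennreal_mult[symmetric] mult.assoc)
    finally show ?thesis by simp
  qed (auto simp: W_def)
  have "{0..<1} \<subseteq> (\<Union>i. W i)" using U(3) W by (force simp: V_def)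
  then have "emeasure lborel {0..<1::real} \<le> emeasure lborel (\<Union>i. W i)"
    by (intro emeasure_mono) (auto simp: W_def)
  also have "\<dots> \<le> (\<Sum>i. emeasure lborel (W i))"
    by (intro emeasure_subadditive_countably) (auto simp: W_def)
  also have "\<dots> \<le> (\<Sum>i. ennreal (2 * C) * diam_power s (U i))"
    by (intro suminf_le e) auto
  also have "\<dots> = ennreal (2 * C) * (\<Sum>i. diam_power s (U i))" by simp
  also have "\<dots> \<le> ennreal (2 * C) * ennreal (1 / (4 * C))"
    using U(4) by (intro mult_left_mono) auto
  also have "\<dots> = ennreal (1 / 2)" using \<open>C > 0\<close> by (simp add: ennreal_mult[symmetric])
  finally have "ennreal 1 \<le> ennreal (1 / 2)" by simp
  then show False by (subst (asm) ennreal_le_iff) auto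
qed

text \<open>
  For \<open>s > 0\<close> and \<open>\<bar>z\<bar> \<le> 1\<close> this is the Riesz kernel \<open>\<bar>z\<bar> powr (- s)\<close> up to constants. The dyadic form has value \<open>\<infinity>\<close> at 0, and its
  integrals reduce to measures of the sets where \<open>\<bar>z\<bar>\<close> is small.
\<close>

definition dyadic_kernel :: "real \<Rightarrow> real \<Rightarrow> ennreal" where
  "dyadic_kernel s z = (\<Sum>n. ennreal (2 powr (s * real n)) * indicator {z. \<bar>z\<bar> \<le> 2 powr - real n} z)"

lemma dyadic_kernel_measurable [measurable]: "dyadic_kernel s \<in> borel_measurable borel"
proof -
  have [measurable]: "{z::real. \<bar>z\<bar> \<le> c} \<in> sets borel" for c by measurable
  show ?thesis unfolding dyadic_kernel_def[abs_def] by measurable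
qed

lemma dyadic_kernel_ge: "\<bar>z\<bar> \<le> 2 powr - real n \<Longrightarrow> ennreal (2 powr (s * real n)) \<le> dyadic_kernel s z"
  unfolding dyadic_kernel_def
  by (rule order_trans[OF _ sum_le_suminf[of _ "{n}"]]) auto

text \<open>
  The energy method: finite energy of the image of Lebesgue measure under \<open>f\<close>. If the potential is at most
  \<open>N\<close> at a point whose image lies in \<open>U\<close>, then the preimage of \<open>U\<close> has measure at most \<open>N\<close> times a
  constant times the \<open>s\<close>-th power of the diameter of \<open>U\<close>. So if the image were null, then all sets
  where the potential is bounded would be null, although their union is almost all of \<open>[0, 1)\<close>.
\<close>

lemma hausdorff_measure_pos_potential:
  fixes f :: "real \<Rightarrow> real"
  assumes f [measurable]: "f \<in> borel_measurable borel" and "0 < s"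
    and fin: "(\<integral>\<^sup>+x\<in>{0..<1}. (\<integral>\<^sup>+y\<in>{0..<1}. dyadic_kernel s (f x - f y) \<partial>lborel) \<partial>lborel) < \<infinity>"
  shows "hausdorff_measure s (f ` {0..<1}) \<noteq> 0"
proof
  assume null: "hausdorff_measure s (f ` {0..<1}) = 0"
  define \<Phi> where "\<Phi> x = (\<integral>\<^sup>+y\<in>{0..<1}. dyadic_kernel s (f x - f y) \<partial>lborel)" for x
  have \<Phi> [measurable]: "\<Phi> \<in> borel_measurable borel" unfolding \<Phi>_def by measurable
  define F where "F N = {x \<in> {0..<1}. \<Phi> x \<le> of_nat N}" for N :: nat
  have F [measurable]: "F N \<in> sets borel" for N unfolding F_def by measurable
  have "emeasure lborel (F N) = 0" for N
  proof -
    define c where "c = of_nat N * ennreal (2 powr s)"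
    have "emeasure lborel (F N) \<le> ennreal e" if "e > 0" for e
    proof -
      define e' where "e' = e / (real N * 2 powr s + 1)"
      have e': "e' > 0" using \<open>e > 0\<close> by (auto simp: e'_def intro!: divide_pos_pos add_nonneg_pos)
      obtain U where U: "\<And>i. bounded (U i)" "\<And>i. diameter (U i) \<le> 1" "f ` {0..<1} \<subseteq> (\<Union>i. U i)"
        "(\<Sum>i::nat. diam_power s (U i)) < ennreal e'"
        using hausdorff_measure_0_cover[OF null e' zero_less_one] by blast
      \<comment> \<open>The closure has the same diameter and makes the preimage measurable.\<close>
      define V where "V i = {x \<in> F N. f x \<in> closure (U i)}" for i
      have V [measurable]: "V i \<in> sets borel" for i
      proof -
        have "V i = F N \<inter> (f -` closure (U i))" by (auto simp: V_def)
        then show ?thesis using measurable_sets_borel[OF f borel_closed[OF closed_closure]] by simp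
      qed
      have bd: "emeasure lborel (V i) \<le> c * diam_power s (U i)" for i
      proof (cases "V i = {}")
        case False
        then obtain x where x: "x \<in> V i" by blast
        then have ne: "U i \<noteq> {}" by (auto simp: V_def)
        let ?d = "diameter (U i)"
        have d: "0 \<le> ?d" "?d \<le> 1" using U by (auto intro: diameter_ge_0)
        have small: "emeasure lborel (V i) \<le> of_nat N * ennreal (2 powr (- (s * real n)))" if n: "?d \<le> 2 powr - real n" for n
        proof -
          have "ennreal (2 powr (s * real n)) * emeasure lborel (V i)
              = (\<integral>\<^sup>+y. ennreal (2 powr (s * real n)) * indicator (V i) y \<partial>lborel)"
            by (simp add: nn_integral_cmult)
          also have "\<dots> \<le> \<Phi> x" unfolding \<Phi>_def
          proof (intro nn_integral_mono)
            fix y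
            show "ennreal (2 powr (s * real n)) * indicator (V i) y \<le> dyadic_kernel s (f x - f y) * indicator {0..<1} y"
            proof (cases "y \<in> V i")
              case True
              have "\<bar>f x - f y\<bar> \<le> diameter (closure (U i))"
                using diameter_bounded_bound[of "closure (U i)" "f x" "f y"] U(1)[of i] x True
                by (auto simp: V_def dist_real_def bounded_closure)
              then have "\<bar>f x - f y\<bar> \<le> 2 powr - real n" using n U(1)[of i] by (simp add: diameter_closure)
              then show ?thesis using True dyadic_kernel_ge by (auto simp: V_def F_def)
            qed auto
          qed
          also have "\<dots> \<le> of_nat N" using x by (auto simp: V_def F_def)
          finally have "ennreal (2 powr (- (s * real n))) * (ennreal (2 powr (s * real n)) * emeasure lborel (V i))
              \<le> ennreal (2 powr (- (s * real n))) * of_nat N" by (rule mult_left_mono) auto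
          moreover have "ennreal (2 powr (- (s * real n))) * (ennreal (2 powr (s * real n)) * emeasure lborel (V i)) = emeasure lborel (V i)"
            by (simp add: mult.assoc[symmetric] ennreal_mult[symmetric] powr_add[symmetric])
          ultimately show ?thesis by (simp add: mult.commute)
        qed
        show ?thesis
        \<comment> \<open>For diameter 0 the bound holds at all dyadic scales; otherwise \<open>n\<close> is the scale of the diameter.\<close>
        proof (cases "?d = 0")
          case True
          have "(\<lambda>n. ennreal (real N * 2 powr (- (s * real n)))) \<longlonglongrightarrow> ennreal 0"
            using \<open>s > 0\<close> by (intro tendsto_ennrealI) real_asymp
          then have "emeasure lborel (V i) \<le> ennreal 0"
          proof (rule LIMSEQ_le_const)
            show "\<exists>M. \<forall>n\<ge>M. emeasure lborel (V i) \<le> ennreal (real N * 2 powr (- (s * real n)))"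
              using small True by (auto simp: ennreal_mult ennreal_of_nat_eq_real_of_nat)
          qed
          then show ?thesis by simp
        next
          case False
          define n where "n = nat \<lfloor>- log 2 ?d\<rfloor>"
          have dpos: "?d > 0" using False d by auto
          then have "log 2 ?d \<le> 0" using d by simp
          then have n: "real n \<le> - log 2 ?d" "- log 2 ?d \<le> real n + 1" unfolding n_def by linarith+
          have "?d \<le> 2 powr - real n" using n(1) dpos by (simp add: log_le_iff[symmetric])
          then have "emeasure lborel (V i) \<le> of_nat N * ennreal (2 powr (- (s * real n)))" by (rule small)
          also have "\<dots> \<le> of_nat N * ennreal (2 powr s * ?d powr s)"
          proof (intro mult_left_mono ennreal_leI)
            have "s * (- real n) \<le> s * (log 2 ?d + 1)"
              using n(2) \<open>s > 0\<close> by (intro mult_left_mono) auto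
            then have "2 powr (- (s * real n)) \<le> 2 powr (s * (log 2 ?d + 1))" by simp
            also have "2 powr (s * (log 2 ?d + 1)) = 2 powr s * (2 powr (log 2 ?d)) powr s"
              by (simp add: powr_powr powr_add[symmetric] algebra_simps)
            also have "\<dots> = 2 powr s * ?d powr s" using dpos by simp
            finally show "2 powr (- (s * real n)) \<le> 2 powr s * ?d powr s" .
          qed auto
          finally show ?thesis using ne \<open>s > 0\<close>
            by (simp add: c_def diam_power_def ennreal_mult mult.assoc)
        qed
      qed auto
      have "F N \<subseteq> (\<Union>i. V i)"
      proof
        fix x assume "x \<in> F N"
        then have "f x \<in> f ` {0..<1}" by (auto simp: F_def)
        then obtain i where "f x \<in> U i" using U(3) by blast
        then show "x \<in> (\<Union>i. V i)" using closure_subset[of "U i"] \<open>x \<in> F N\<close> by (auto simp: V_def)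
      qed
      then have "emeasure lborel (F N) \<le> emeasure lborel (\<Union>i. V i)"
        by (intro emeasure_mono) auto
      also have "\<dots> \<le> (\<Sum>i. emeasure lborel (V i))"
        by (intro emeasure_subadditive_countably) auto
      also have "\<dots> \<le> (\<Sum>i. c * diam_power s (U i))" by (intro suminf_le bd) auto
      also have "\<dots> = c * (\<Sum>i. diam_power s (U i))" by simp
      also have "\<dots> \<le> c * ennreal e'" using U(4) by (intro mult_left_mono) auto
      also have "\<dots> = ennreal (real N * 2 powr s * e')"
        using e' by (simp add: c_def ennreal_mult ennreal_of_nat_eq_real_of_nat)
      also have "\<dots> \<le> ennreal e"
      proof (rule ennreal_leI)
        have "real N * 2 powr s * e' \<le> (real N * 2 powr s + 1) * e'" using e' by (intro mult_right_mono) auto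
        also have "\<dots> = e" unfolding e'_def using add_nonneg_pos[of "real N * 2 powr s" 1] by simp
        finally show "real N * 2 powr s * e' \<le> e" .
      qed
      finally show ?thesis .
    qed
    then have "emeasure lborel (F N) \<le> 0" by - (rule ennreal_le_epsilon, simp)
    then show ?thesis by simp
  qed
  then have "F N \<in> null_sets lborel" for N by (intro null_setsI) auto
  then have "AE x in lborel. \<forall>N. x \<notin> F N" unfolding AE_all_countable using AE_not_in by blast
  moreover have "AE x in lborel. \<Phi> x * indicator {0..<1} x \<noteq> \<infinity>"
    using fin by (intro nn_integral_PInf_AE) (auto simp: \<Phi>_def[symmetric])
  ultimately have "AE x in lborel. x \<notin> {0..<1::real}"
  proof eventually_elim
    case (elim x)
    show ?case
    proof
      assume x: "x \<in> {0..<1}"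
      then have "\<Phi> x < \<infinity>" using elim by (auto simp: less_top)
      then obtain N :: nat where "\<Phi> x \<le> of_nat N"
        by (metis ennreal_Ex_less_of_nat infinity_ennreal_def less_imp_le)
      then show False using elim x by (auto simp: F_def)
    qed
  qed
  then have "emeasure lborel {0..<1::real} = 0"
    by (subst (asm) AE_iff_measurable[of "{0..<1}"]) auto
  then show False by simp
qed

section \<open>Images in almost every direction\<close>

text \<open>
  If \<open>\<bar>w\<bar>\<close> is small compared with \<open>\<bar>u\<bar>\<close>, then \<open>u + (t - c) w\<close> stays away from 0; otherwise it moves with speed at least
  \<open>\<bar>u\<bar> / (2 R)\<close>. Either way the bound is \<open>4 R r / \<bar>u\<bar>\<close>, which does not depend on \<open>w\<close>. As the measure is at most
  \<open>2 R\<close> in any case, the power 1 of \<open>r / \<bar>u\<bar>\<close> can be lowered to \<open>\<sigma>\<close>; for \<open>\<sigma> < 1\<close> the bound is integrable in \<open>u\<close>.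
\<close>

lemma emeasure_pencil_le:
  fixes u w c r R \<sigma> :: real
  assumes "u \<noteq> 0" "0 < \<sigma>" "\<sigma> \<le> 1" "0 < r" "0 < R"
  shows "emeasure lborel {t \<in> {c - R..c + R}. \<bar>u + (t - c) * w\<bar> \<le> r}
           \<le> ennreal (4 * R * (r powr \<sigma> * \<bar>u\<bar> powr - \<sigma>))" (is "emeasure _ ?S \<le> _")
proof -
  have q: "r powr \<sigma> * \<bar>u\<bar> powr - \<sigma> = (r / \<bar>u\<bar>) powr \<sigma>"
    using assms by (simp add: powr_divide powr_minus field_simps)
  have full: "emeasure lborel ?S \<le> ennreal (2 * R)"
  proof -
    have "emeasure lborel ?S \<le> emeasure lborel {c - R..c + R}" by (intro emeasure_mono) auto
    also have "\<dots> = ennreal (2 * R)" using assms by (simp add: emeasure_lborel_Icc)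
    finally show ?thesis .
  qed
  show ?thesis
  proof (cases "\<bar>u\<bar> \<le> r")
    case True
    then have "1 \<le> (r / \<bar>u\<bar>) powr \<sigma>" using assms by (intro ge_one_powr_ge_zero) auto
    then have "2 * R \<le> 4 * R * (r / \<bar>u\<bar>) powr \<sigma>"
      using mult_left_mono[of 1 "(r / \<bar>u\<bar>) powr \<sigma>" "4 * R"] assms by linarith
    then show ?thesis unfolding q using full ennreal_leI order_trans by blast
  next
    case False
    then have "r / \<bar>u\<bar> \<le> 1" "0 < r / \<bar>u\<bar>" using assms by auto
    then have "r / \<bar>u\<bar> \<le> (r / \<bar>u\<bar>) powr \<sigma>" using powr_mono'[of \<sigma> 1 "r / \<bar>u\<bar>"] assms by auto
    then have le: "4 * R * (r / \<bar>u\<bar>) \<le> 4 * R * (r / \<bar>u\<bar>) powr \<sigma>"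
      using assms by (intro mult_left_mono) auto
    have "emeasure lborel ?S \<le> ennreal (4 * R * (r / \<bar>u\<bar>))"
    proof (cases "R * \<bar>w\<bar> \<le> \<bar>u\<bar> / 2")
      case True
      show ?thesis
      proof (cases "?S = {}")
        case False
        then obtain t where "t \<in> ?S" by blast
        then have t: "\<bar>t - c\<bar> \<le> R" "\<bar>u + (t - c) * w\<bar> \<le> r" by auto
        have "\<bar>(t - c) * w\<bar> \<le> R * \<bar>w\<bar>" using t by (simp add: abs_mult mult_right_mono)
        then have "\<bar>u\<bar> \<le> 2 * r" using t True by linarith
        then have "2 * R * \<bar>u\<bar> \<le> 2 * R * (2 * r)" using assms by (intro mult_left_mono) auto
        then have "2 * R \<le> 4 * R * (r / \<bar>u\<bar>)" using assms by (simp add: field_simps)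
        then show ?thesis using full ennreal_leI order_trans by blast
      next
        case True
        show ?thesis unfolding True by simp
      qed
    next
      case False
      then have w: "\<bar>u\<bar> / 2 < R * \<bar>w\<bar>" "w \<noteq> 0" by auto
      have "?S \<subseteq> cball (c - u / w) (r / \<bar>w\<bar>)"
      proof
        fix t assume "t \<in> ?S"
        then have "\<bar>u + (t - c) * w\<bar> \<le> r" by auto
        moreover have "u + (t - c) * w = (t - (c - u / w)) * w" using w by (simp add: field_simps)
        ultimately have "\<bar>t - (c - u / w)\<bar> * \<bar>w\<bar> \<le> r" by (simp add: abs_mult)
        then have "\<bar>t - (c - u / w)\<bar> \<le> r / \<bar>w\<bar>" using w by (simp add: pos_le_divide_eq)
        then show "t \<in> cball (c - u / w) (r / \<bar>w\<bar>)" by (simp add: dist_real_def abs_minus_commute)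
      qed
      then have "emeasure lborel ?S \<le> emeasure lborel (cball (c - u / w) (r / \<bar>w\<bar>))"
        by (intro emeasure_mono) auto
      also have "\<dots> = ennreal (2 * (r / \<bar>w\<bar>))"
        using assms w by (simp add: cball_eq_atLeastAtMost)
      also have "\<dots> \<le> ennreal (4 * R * (r / \<bar>u\<bar>))"
      proof (rule ennreal_leI)
        have "r * \<bar>u\<bar> \<le> r * (2 * R * \<bar>w\<bar>)" using w assms by (intro mult_left_mono) auto
        then show "2 * (r / \<bar>w\<bar>) \<le> 4 * R * (r / \<bar>u\<bar>)" using w assms by (simp add: field_simps)
      qed
      finally show ?thesis .
    qed
    then show ?thesis unfolding q using le ennreal_leI order_trans by blast
  qed
qed

text \<open>
  Averaging over the parameter replaces the distance of two image points by the distance \<open>\<bar>u\<bar>\<close> of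
  their preimages, at the price of an exponent \<open>\<sigma>\<close> slightly larger than \<open>s\<close>.
\<close>

lemma dyadic_kernel_pencil_le:
  assumes "0 < s" "s < \<sigma>" "\<sigma> \<le> 1" "0 < R"
  obtains K where "K < \<infinity>" "\<And>u w c. u \<noteq> 0 \<Longrightarrow>
    (\<integral>\<^sup>+t\<in>{c - R..c + R}. dyadic_kernel s (u + (t - c) * w) \<partial>lborel) \<le> K * ennreal (\<bar>u\<bar> powr - \<sigma>)"
proof
  let ?a = "\<lambda>n. 4 * R * (2 powr (s - \<sigma>)) ^ n"
  define K where "K = (\<Sum>n. ennreal (?a n))"
  have "2 powr (s - \<sigma>) < 2 powr (0::real)" using assms by (intro powr_less_mono) auto
  then have "summable ?a" by (intro summable_mult summable_geometric) auto
  then show "K < \<infinity>" unfolding K_def using assms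
    by (subst suminf_ennreal2) auto
  fix u w c :: real assume u: "u \<noteq> 0"
  have "(\<integral>\<^sup>+t\<in>{c - R..c + R}. dyadic_kernel s (u + (t - c) * w) \<partial>lborel)
      = (\<integral>\<^sup>+t. (\<Sum>n. ennreal (2 powr (s * real n)) *
            indicator {t \<in> {c - R..c + R}. \<bar>u + (t - c) * w\<bar> \<le> 2 powr - real n} t) \<partial>lborel)"
    unfolding dyadic_kernel_def ennreal_suminf_multc[symmetric]
    by (intro nn_integral_cong suminf_cong) (auto simp: indicator_def)
  also have "\<dots> = (\<Sum>n. \<integral>\<^sup>+t. ennreal (2 powr (s * real n)) *
            indicator {t \<in> {c - R..c + R}. \<bar>u + (t - c) * w\<bar> \<le> 2 powr - real n} t \<partial>lborel)"
    by (intro nn_integral_suminf) measurable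
  also have "\<dots> = (\<Sum>n. ennreal (2 powr (s * real n)) *
            emeasure lborel {t \<in> {c - R..c + R}. \<bar>u + (t - c) * w\<bar> \<le> 2 powr - real n})"
    by (intro suminf_cong nn_integral_cmult_indicator) measurable
  also have "\<dots> \<le> (\<Sum>n. ennreal (?a n) * ennreal (\<bar>u\<bar> powr - \<sigma>))"
  proof (intro suminf_le)
    fix n
    have "ennreal (2 powr (s * real n)) *
            emeasure lborel {t \<in> {c - R..c + R}. \<bar>u + (t - c) * w\<bar> \<le> 2 powr - real n}
        \<le> ennreal (2 powr (s * real n)) * ennreal (4 * R * ((2 powr - real n) powr \<sigma> * \<bar>u\<bar> powr - \<sigma>))"
      using assms u by (intro mult_left_mono emeasure_pencil_le) auto
    also have "\<dots> = ennreal (2 powr (s * real n) * (2 powr - real n) powr \<sigma> * (4 * R * \<bar>u\<bar> powr - \<sigma>))"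
      using assms by (simp add: ennreal_mult[symmetric] mult_ac)
    also have "2 powr (s * real n) * (2 powr - real n) powr \<sigma> = (2 powr (s - \<sigma>)) ^ n"
      by (simp add: powr_powr powr_add[symmetric] powr_realpow[symmetric] algebra_simps)
    also have "ennreal ((2 powr (s - \<sigma>)) ^ n * (4 * R * \<bar>u\<bar> powr - \<sigma>)) = ennreal (?a n) * ennreal (\<bar>u\<bar> powr - \<sigma>)"
      using assms by (simp add: ennreal_mult[symmetric] mult_ac)
    finally show "ennreal (2 powr (s * real n)) *
            emeasure lborel {t \<in> {c - R..c + R}. \<bar>u + (t - c) * w\<bar> \<le> 2 powr - real n}
        \<le> ennreal (?a n) * ennreal (\<bar>u\<bar> powr - \<sigma>)" .
  qed auto
  also have "\<dots> = K * ennreal (\<bar>u\<bar> powr - \<sigma>)" by (simp add: K_def)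
  finally show "(\<integral>\<^sup>+t\<in>{c - R..c + R}. dyadic_kernel s (u + (t - c) * w) \<partial>lborel) \<le> K * ennreal (\<bar>u\<bar> powr - \<sigma>)" .
qed

lemma nn_integral_abs_diff_powr_le:
  fixes x \<sigma> :: real
  assumes "0 < \<sigma>" "\<sigma> < 1" "x \<in> {0..<1}"
  shows "(\<integral>\<^sup>+y\<in>{0..<1}. ennreal (\<bar>x - y\<bar> powr - \<sigma>) \<partial>lborel) \<le> ennreal (2 / (1 - \<sigma>))"
proof -
  let ?h = "\<lambda>z. ennreal (\<bar>z\<bar> powr - \<sigma>)"
  have "((\<lambda>z. z powr - \<sigma>) has_integral (1 / (1 - \<sigma>))) {0..1}"
    using has_integral_powr_from_0[of "- \<sigma>" 1] assms by simp
  then have "((\<lambda>z. \<bar>z\<bar> powr - \<sigma>) has_integral (1 / (1 - \<sigma>))) {0..1}"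
    by (rule has_integral_eq[rotated]) auto
  then have p: "(\<integral>\<^sup>+z\<in>{0..1}. ?h z \<partial>lborel) = ennreal (1 / (1 - \<sigma>))"
    by (intro nn_integral_has_integral_lebesgue') (auto intro!: borel_measurable_indicator) 
  have m: "(\<integral>\<^sup>+z\<in>{-1..0}. ?h z \<partial>lborel) = (\<integral>\<^sup>+z\<in>{0..1}. ?h z \<partial>lborel)"
    by (subst nn_integral_real_affine[of _ "-1" 0]) (auto intro!: nn_integral_cong simp: indicator_def)
  have "(\<integral>\<^sup>+y\<in>{0..<1}. ?h (x - y) \<partial>lborel) = (\<integral>\<^sup>+z. ?h z * indicator {0..<1} (x - z) \<partial>lborel)"
    by (subst nn_integral_real_affine[of _ "-1" x]) auto
  also have "\<dots> \<le> (\<integral>\<^sup>+z. ?h z * indicator {-1..0} z + ?h z * indicator {0..1} z \<partial>lborel)"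
    using assms by (intro nn_integral_mono) (auto simp: indicator_def)
  also have "\<dots> = ennreal (1 / (1 - \<sigma>)) + ennreal (1 / (1 - \<sigma>))"
    by (subst nn_integral_add) (auto simp: m p)
  also have "\<dots> = ennreal (2 / (1 - \<sigma>))" using assms by (simp flip: ennreal_plus)
  finally show ?thesis .
qed

text \<open>
  By Tonelli's theorem the energies of the image measures have a finite integral over every bounded set of
  parameters, so almost all of them are finite.
\<close>

lemma AE_hausdorff_measure_pencil_pos:
  fixes \<beta> :: "real \<Rightarrow> real" and s c :: real
  assumes [measurable]: "\<beta> \<in> borel_measurable borel" and s: "0 < s" "s < 1"
  shows "AE \<xi> in lborel. hausdorff_measure s ((\<lambda>x. x + (\<xi> - c) * \<beta> x) ` {0..<1}) \<noteq> 0"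
proof -
  define \<sigma> where "\<sigma> = (s + 1) / 2"
  have \<sigma>: "s < \<sigma>" "\<sigma> < 1" using s by (auto simp: \<sigma>_def)
  define E where "E \<xi> = (\<integral>\<^sup>+x\<in>{0..<1}. (\<integral>\<^sup>+y\<in>{0..<1}.
      dyadic_kernel s ((x + (\<xi> - c) * \<beta> x) - (y + (\<xi> - c) * \<beta> y)) \<partial>lborel) \<partial>lborel)" for \<xi>
  have E_alt: "E \<xi> = (\<integral>\<^sup>+x\<in>{0..<1}. (\<integral>\<^sup>+y\<in>{0..<1}.
      dyadic_kernel s ((x - y) + (\<xi> - c) * (\<beta> x - \<beta> y)) \<partial>lborel) \<partial>lborel)" for \<xi>
    unfolding E_def by (simp add: algebra_simps)
  have E [measurable]: "E \<in> borel_measurable borel" unfolding E_def by measurable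
  have "AE \<xi> in lborel. \<xi> \<in> {c - real (Suc n) .. c + real (Suc n)} \<longrightarrow> E \<xi> \<noteq> \<infinity>" for n
  proof -
    let ?R = "real (Suc n)"
    obtain K where K: "K < \<infinity>" "\<And>u w c. u \<noteq> 0 \<Longrightarrow>
      (\<integral>\<^sup>+t\<in>{c - ?R..c + ?R}. dyadic_kernel s (u + (t - c) * w) \<partial>lborel) \<le> K * ennreal (\<bar>u\<bar> powr - \<sigma>)"
      using dyadic_kernel_pencil_le[of s \<sigma> ?R] s \<sigma> by auto
    let ?k = "\<lambda>\<xi> x y. dyadic_kernel s ((x - y) + (\<xi> - c) * (\<beta> x - \<beta> y)) 
        * indicator {0..<1} y * indicator {0..<1} x * indicator {c - ?R..c + ?R} \<xi>"
    have "(\<integral>\<^sup>+\<xi>\<in>{c - ?R..c + ?R}. E \<xi> \<partial>lborel) = (\<integral>\<^sup>+\<xi>. \<integral>\<^sup>+x. \<integral>\<^sup>+y. ?k \<xi> x y \<partial>lborel \<partial>lborel \<partial>lborel)"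
      unfolding E_alt by (simp add: nn_integral_multc)
    also have "\<dots> = (\<integral>\<^sup>+x. \<integral>\<^sup>+\<xi>. \<integral>\<^sup>+y. ?k \<xi> x y \<partial>lborel \<partial>lborel \<partial>lborel)"
      by (rule lborel_pair.Fubini') measurable
    also have "\<dots> = (\<integral>\<^sup>+x. \<integral>\<^sup>+y. \<integral>\<^sup>+\<xi>. ?k \<xi> x y \<partial>lborel \<partial>lborel \<partial>lborel)"
      by (intro nn_integral_cong lborel_pair.Fubini') measurable
    also have "\<dots> \<le> (\<integral>\<^sup>+x. (K * ennreal (2 / (1 - \<sigma>))) * indicator {0..<1::real} x \<partial>lborel)"
    proof (intro nn_integral_mono)
      fix x :: real
      show "(\<integral>\<^sup>+y. \<integral>\<^sup>+\<xi>. ?k \<xi> x y \<partial>lborel \<partial>lborel) \<le> (K * ennreal (2 / (1 - \<sigma>))) * indicator {0..<1} x"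
      proof (cases "x \<in> {0..<1}")
        case True
        have "(\<integral>\<^sup>+y. \<integral>\<^sup>+\<xi>. ?k \<xi> x y \<partial>lborel \<partial>lborel)
            \<le> (\<integral>\<^sup>+y. K * (ennreal (\<bar>x - y\<bar> powr - \<sigma>) * indicator {0..<1} y) \<partial>lborel)"
        proof (rule nn_integral_mono_AE)
          have "(\<integral>\<^sup>+\<xi>. ?k \<xi> x y \<partial>lborel) \<le> K * (ennreal (\<bar>x - y\<bar> powr - \<sigma>) * indicator {0..<1} y)"
            if "y \<noteq> x" for y
            using K(2)[of "x - y" c "\<beta> x - \<beta> y"] True that by (cases "y \<in> {0..<1}") auto
          then show "AE y in lborel. (\<integral>\<^sup>+\<xi>. ?k \<xi> x y \<partial>lborel)
              \<le> K * (ennreal (\<bar>x - y\<bar> powr - \<sigma>) * indicator {0..<1} y)"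
            using AE_lborel_singleton[of x] by (auto elim: AE_mp)
        qed
        also have "\<dots> = K * (\<integral>\<^sup>+y\<in>{0..<1}. ennreal (\<bar>x - y\<bar> powr - \<sigma>) \<partial>lborel)"
          by (rule nn_integral_cmult) measurable
        also have "\<dots> \<le> K * ennreal (2 / (1 - \<sigma>))"
          using s \<sigma> True by (intro mult_left_mono nn_integral_abs_diff_powr_le) auto
        finally show ?thesis using True by simp
      qed auto
    qed
    also have "\<dots> = K * ennreal (2 / (1 - \<sigma>))" by (subst nn_integral_cmult_indicator) auto
    also have "\<dots> < \<infinity>" using K(1) by (simp add: ennreal_mult_less_top)
    finally have "AE \<xi> in lborel. E \<xi> * indicator {c - ?R..c + ?R} \<xi> \<noteq> \<infinity>"
      by (intro nn_integral_PInf_AE) auto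
    then show ?thesis by eventually_elim auto
  qed
  then have "AE \<xi> in lborel. \<forall>n. \<xi> \<in> {c - real (Suc n) .. c + real (Suc n)} \<longrightarrow> E \<xi> \<noteq> \<infinity>"
    unfolding AE_all_countable by blast
  then show ?thesis
  proof eventually_elim
    case (elim \<xi>)
    obtain n :: nat where "\<bar>\<xi> - c\<bar> \<le> real n" using real_arch_simple by blast
    then have "\<xi> \<in> {c - real (Suc n) .. c + real (Suc n)}" by auto
    then have "E \<xi> < \<infinity>" using elim by (auto simp: less_top)
    then show ?case
      using s unfolding E_def by (intro hausdorff_measure_pos_potential) auto
  qed
qed

section \<open>Mixed radix expansions and lacunary series\<close>

definition radix_prod :: "(nat \<Rightarrow> nat) \<Rightarrow> nat \<Rightarrow> nat" where
  "radix_prod m k = (\<Prod>i<k. m i)"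

definition digit :: "(nat \<Rightarrow> nat) \<Rightarrow> real \<Rightarrow> nat \<Rightarrow> nat" where
  "digit m x i = nat (\<lfloor>real (radix_prod m (Suc i)) * x\<rfloor> mod int (m i))"

lemma radix_prod_0 [simp]: "radix_prod m 0 = 1"
  and radix_prod_Suc: "radix_prod m (Suc k) = m k * radix_prod m k"
  by (simp_all add: radix_prod_def mult.commute)

lemma radix_prod_pos: "(\<And>i. 0 < m i) \<Longrightarrow> 0 < radix_prod m k"
  by (simp add: radix_prod_def prod_pos)

lemma digit_less: "0 < m i \<Longrightarrow> digit m x i < m i"
  by (simp add: digit_def nat_less_iff)

text \<open>
  The first \<open>k\<close> digits of \<open>x\<close> encode the integer part of \<open>x\<close> times the \<open>k\<close>-th radix product.
\<close>

lemma sum_digits: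
  fixes x :: real
  assumes m: "\<And>i. 0 < m i" and "x \<in> {0..<1}"
  shows "(\<Sum>i<k. real (digit m x i) / radix_prod m (Suc i)) = \<lfloor>radix_prod m k * x\<rfloor> / radix_prod m k"
proof (induction k)
  case 0
  have "\<lfloor>x\<rfloor> = 0" using assms(2) by (simp add: floor_eq_iff)
  then show ?case by simp
next
  case (Suc k)
  let ?P = "radix_prod m"
  have P: "real (?P k) > 0" "real (m k) > 0" using radix_prod_pos[of m k] m by auto
  have "\<lfloor>?P k * x\<rfloor> = \<lfloor>real (?P (Suc k)) * x / real (m k)\<rfloor>"
    using P by (simp add: radix_prod_Suc)
  also have "\<dots> = \<lfloor>?P (Suc k) * x\<rfloor> div int (m k)"
    using floor_divide_real_eq_div[of "int (m k)" "?P (Suc k) * x"] by simp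
  finally have "\<lfloor>?P (Suc k) * x\<rfloor> = int (m k) * \<lfloor>?P k * x\<rfloor> + int (digit m x k)"
    using m[of k] by (simp add: digit_def)
  then have "real_of_int \<lfloor>?P (Suc k) * x\<rfloor> / ?P (Suc k)
      = real_of_int (int (m k) * \<lfloor>?P k * x\<rfloor> + int (digit m x k)) / ?P (Suc k)" by simp
  also have "\<dots> = \<lfloor>?P k * x\<rfloor> / ?P k + real (digit m x k) / ?P (Suc k)"
    using P by (simp add: add_divide_distrib radix_prod_Suc)
  finally show ?case using Suc by simp
qed

lemma abs_diff_less_if_digits_eq:
  fixes x y :: real
  assumes m: "\<And>i. 0 < m i" and "x \<in> {0..<1}" "y \<in> {0..<1}" and eq: "\<And>i. i < k \<Longrightarrow> digit m x i = digit m y i"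
  shows "\<bar>x - y\<bar> < 1 / radix_prod m k"
proof -
  have P: "real (radix_prod m k) > 0" using radix_prod_pos[of m k] m by auto
  have "(\<Sum>i<k. real (digit m x i) / radix_prod m (Suc i)) = (\<Sum>i<k. real (digit m y i) / radix_prod m (Suc i))"
    using eq by (intro sum.cong) auto
  then have "\<lfloor>radix_prod m k * x\<rfloor> = \<lfloor>radix_prod m k * y\<rfloor>"
    using P unfolding sum_digits[OF m assms(2)] sum_digits[OF m assms(3)] by simp
  then have "\<bar>radix_prod m k * x - radix_prod m k * y\<bar> < 1" by linarith
  moreover have "radix_prod m k * x - radix_prod m k * y = (x - y) * radix_prod m k" by (simp add: algebra_simps)
  ultimately have "\<bar>x - y\<bar> * radix_prod m k < 1" by (simp add: abs_mult)
  then show ?thesis using P by (simp add: pos_less_divide_eq)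
qed

lemma digits_sums:
  fixes x :: real
  assumes m: "\<And>i. 0 < m i" and "x \<in> {0..<1}" and "\<And>k. real k \<le> radix_prod m k"
  shows "(\<lambda>i. real (digit m x i) / radix_prod m (Suc i)) sums x"
  unfolding sums_def
proof (rule tendsto_sandwich)
  have P: "real (radix_prod m k) > 0" for k using radix_prod_pos[of m k] m by auto
  have f: "x - 1 / radix_prod m k \<le> \<lfloor>radix_prod m k * x\<rfloor> / radix_prod m k"
    "\<lfloor>radix_prod m k * x\<rfloor> / radix_prod m k \<le> x" for k
  proof -
    have "radix_prod m k * x - 1 \<le> \<lfloor>radix_prod m k * x\<rfloor>" "\<lfloor>radix_prod m k * x\<rfloor> \<le> radix_prod m k * x" by linarith+
    then have "(radix_prod m k * x - 1) / radix_prod m k \<le> \<lfloor>radix_prod m k * x\<rfloor> / radix_prod m k"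
      "\<lfloor>radix_prod m k * x\<rfloor> / radix_prod m k \<le> (radix_prod m k * x) / radix_prod m k"
      using P[of k] by (intro divide_right_mono; simp)+
    then show "x - 1 / radix_prod m k \<le> \<lfloor>radix_prod m k * x\<rfloor> / radix_prod m k"
      "\<lfloor>radix_prod m k * x\<rfloor> / radix_prod m k \<le> x" using P[of k] by (simp_all add: diff_divide_distrib)
  qed
  show "\<forall>\<^sub>F k in sequentially. x - 1 / real k \<le> (\<Sum>i<k. real (digit m x i) / radix_prod m (Suc i))"
    using eventually_gt_at_top[of 0]
  proof eventually_elim
    case (elim k)
    then have "1 / real (radix_prod m k) \<le> 1 / real k" using assms(3)[of k] by (intro divide_left_mono) auto
    then show ?case using f[of k] unfolding sum_digits[OF m assms(2)] by linarith
  qed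
  show "\<forall>\<^sub>F k in sequentially. (\<Sum>i<k. real (digit m x i) / radix_prod m (Suc i)) \<le> x"
    using f unfolding sum_digits[OF m assms(2)] by simp
  show "(\<lambda>k. x - 1 / real k) \<longlonglongrightarrow> x" by real_asymp
qed simp

lemma measurable_digit_prefix [measurable]:
  "(\<lambda>x. map (digit m x) [0..<k]) \<in> borel \<rightarrow>\<^sub>M count_space UNIV"
proof (induction k)
  case (Suc k)
  have "(\<lambda>x. digit m x k) \<in> borel \<rightarrow>\<^sub>M count_space UNIV" unfolding digit_def by measurable
  then have "(\<lambda>x. u @ [digit m x k]) \<in> borel \<rightarrow>\<^sub>M count_space UNIV" for u
    by (rule measurable_compose) simp
  then have "(\<lambda>x. map (digit m x) [0..<k] @ [digit m x k]) \<in> borel \<rightarrow>\<^sub>M count_space UNIV"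
    by (rule measurable_compose_countable[OF _ Suc])
  then show ?case by simp
qed simp

text \<open>
  A series dominated by \<open>c / 2 ^ g i\<close> with a strictly increasing \<open>g\<close> is dominated by a geometric series.
\<close>

lemma lacunary_tail:
  fixes a :: "nat \<Rightarrow> real"
  assumes g: "\<And>i. g i < g (Suc i)" and a: "\<And>i. i \<ge> n \<Longrightarrow> \<bar>a i\<bar> \<le> c / 2 ^ g i"
  shows "summable a" "\<bar>suminf a - (\<Sum>i<n. a i)\<bar> \<le> 2 * c / 2 ^ g n"
proof -
  have "c \<ge> 0" using a[of n] by (auto simp: field_simps intro: order_trans[rotated])
  have gi: "g n + i \<le> g (i + n)" for i
  proof (induction i)
    case (Suc i)
    then show ?case using g[of "i + n"] by simp
  qed simp
  have b: "\<bar>a (i + n)\<bar> \<le> c / 2 ^ g n * (1/2) ^ i" for i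
  proof -
    have "\<bar>a (i + n)\<bar> \<le> c / 2 ^ g (i + n)" using a[of "i + n"] by simp
    also have "\<dots> \<le> c / 2 ^ (g n + i)"
      using gi[of i] \<open>c \<ge> 0\<close> by (intro divide_left_mono power_increasing) auto
    finally show ?thesis by (simp add: power_add power_divide)
  qed
  have s: "summable (\<lambda>i. c / 2 ^ g n * (1/2) ^ i)" by (intro summable_mult summable_geometric) auto
  have sa: "summable (\<lambda>i. a (i + n))"
    by (rule summable_comparison_test[OF _ s]) (use b in auto)
  then show sum: "summable a" by (subst (asm) summable_iff_shift)
  have "suminf a - (\<Sum>i<n. a i) = (\<Sum>i. a (i + n))" using suminf_minus_initial_segment[OF sum, of n] by simp
  also have "\<bar>\<dots>\<bar> \<le> (\<Sum>i. c / 2 ^ g n * (1/2) ^ i)"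
    using b s by (intro norm_suminf_le[where 'a = real, unfolded real_norm_def]) auto
  also have "\<dots> = 2 * c / 2 ^ g n" by (subst suminf_mult) (auto simp: suminf_geometric)
  finally show "\<bar>suminf a - (\<Sum>i<n. a i)\<bar> \<le> 2 * c / 2 ^ g n" .
qed

section \<open>A group of dimension \<open>d\<close> with small covering numbers\<close>

text \<open>
  Of the \<open>2 ^ (2 i + 1)\<close> digits that position \<open>i\<close> of an expansion with denominators \<open>2 ^ i\<^sup>2\<close> offers, about the \<open>d\<close>-th power
  of their number is allowed. The factor \<open>1 / 4\<close> leaves gaps between the allowed blocks, so that different
  digit sequences have well separated sums.
\<close>

definition digit_bound :: "real \<Rightarrow> nat \<Rightarrow> nat" where
  "digit_bound d i = nat \<lfloor>2 powr (d * real (2 * i + 1)) / 4\<rfloor> + 1"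

definition grid_sum :: "nat \<Rightarrow> (nat \<Rightarrow> int) \<Rightarrow> real" where
  "grid_sum n z = (\<Sum>i<n. of_int (z i) / 2 ^ (Suc i)\<^sup>2)"

definition grid :: "real \<Rightarrow> nat \<Rightarrow> nat \<Rightarrow> real set" where
  "grid d j n = grid_sum n ` (\<Pi>\<^sub>E i\<in>{..<n}. {- int (j * digit_bound d i)..int (j * digit_bound d i)})"

text \<open>
  Up to constants, the sums of all series with coefficients \<open>\<bar>z i\<bar> \<le> j * digit_bound d i\<close>. Describing them by
  approximation at every scale makes closedness immediate and lets layers be added term by term, without carries.
\<close>

definition layer :: "real \<Rightarrow> nat \<Rightarrow> real set" where
  "layer d j = (\<Inter>n. \<Union>p\<in>grid d j n. cball p (2 * real j / 2 ^ n\<^sup>2))"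

lemma digit_bound_le: "0 \<le> d \<Longrightarrow> real (digit_bound d i) \<le> 2 powr (d * real (2 * i + 1))"
proof -
  assume "0 \<le> d"
  then have "1 \<le> 2 powr (d * real (2 * i + 1))" by (intro ge_one_powr_ge_zero) auto
  then show ?thesis unfolding digit_bound_def
    by (cases "2 powr (d * real (2 * i + 1)) < 4") (auto simp: floor_eq_iff nat_eq_iff, linarith+)
qed

lemma digit_bound_ge: "2 powr (d * real (2 * i + 1)) / 4 \<le> real (digit_bound d i)"
  unfolding digit_bound_def by linarith

lemma digit_bound_pos: "0 < digit_bound d i"
  by (simp add: digit_bound_def)

lemma digit_bound_less: 
  assumes "0 \<le> d" "d < 1"
  shows "real (digit_bound d i) - 1 \<le> 2 ^ (2 * i + 1) / 4"
proof -
  have "2 powr (d * real (2 * i + 1)) \<le> 2 powr (1 * real (2 * i + 1))"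
    using assms by (intro powr_mono mult_right_mono) auto
  also have "\<dots> = 2 ^ (2 * i + 1)" unfolding mult_1 by (rule powr_realpow) simp
  finally have "2 powr (d * real (2 * i + 1)) / 4 \<le> 2 ^ (2 * i + 1) / 4" by simp
  moreover have "real (digit_bound d i) - 1 \<le> 2 powr (d * real (2 * i + 1)) / 4"
    unfolding digit_bound_def using of_int_floor_le[of "2 powr (d * real (2 * i + 1)) / 4"] by simp
  ultimately show ?thesis by simp
qed

lemma finite_grid: "finite (grid d j n)"
  unfolding grid_def by (intro finite_imageI finite_PiE) auto

lemma prod_two_powr_odd: "(\<Prod>i<n. 2 powr (d * real (2 * i + 1))) = 2 powr (d * real (n\<^sup>2))"
  by (induction n) (simp_all add: powr_add[symmetric] power2_eq_square algebra_simps)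

text \<open>
  The constant to the power \<open>n\<close> is harmless, because the scale is \<open>2 ^ (- n\<^sup>2)\<close>.
\<close>

lemma card_grid_le:
  assumes "0 \<le> d"
  shows "real (card (grid d j n)) \<le> (3 * (real j + 1)) ^ n * 2 powr (d * real (n\<^sup>2))"
proof -
  have "card (grid d j n) \<le> card (\<Pi>\<^sub>E i\<in>{..<n}. {- int (j * digit_bound d i)..int (j * digit_bound d i)})"
    unfolding grid_def by (intro card_image_le finite_PiE) auto
  also have "\<dots> = (\<Prod>i<n. 2 * (j * digit_bound d i) + 1)"
    by (subst card_PiE) (auto intro!: prod.cong simp: nat_eq_iff)
  finally have "real (card (grid d j n)) \<le> (\<Prod>i<n. real (2 * (j * digit_bound d i) + 1))"
    by (metis of_nat_mono of_nat_prod)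
  also have "\<dots> \<le> (\<Prod>i<n. 3 * (real j + 1) * 2 powr (d * real (2 * i + 1)))"
  proof (intro prod_mono conjI)
    fix i
    have b: "1 \<le> real (digit_bound d i)" using digit_bound_pos[of d i] by linarith
    have "real (2 * (j * digit_bound d i) + 1) \<le> 2 * real j * real (digit_bound d i) + real (digit_bound d i)"
      using b by simp
    also have "\<dots> \<le> 3 * (real j + 1) * real (digit_bound d i)" using b by (simp add: algebra_simps)
    also have "\<dots> \<le> 3 * (real j + 1) * 2 powr (d * real (2 * i + 1))"
      by (intro mult_left_mono digit_bound_le assms) auto
    finally show "real (2 * (j * digit_bound d i) + 1) \<le> 3 * (real j + 1) * 2 powr (d * real (2 * i + 1))" .
  qed auto
  also have "\<dots> = (3 * (real j + 1)) ^ n * 2 powr (d * real (n\<^sup>2))"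
    by (simp only: prod.distrib prod_two_powr_odd prod_constant card_lessThan power_mult_distrib)
  finally show ?thesis .
qed

lemma coverable_layer:
  assumes "0 \<le> d"
  shows "coverable ((3 * (real j + 1)) ^ n * 2 powr (d * real (n\<^sup>2))) (2 * real j / 2 ^ n\<^sup>2) (layer d j)"
  by (intro coverableI[OF finite_grid card_grid_le[OF assms]]) (auto simp: layer_def)

lemma closed_layer: "closed (layer d j)"
  unfolding layer_def by (intro closed_INT ballI closed_UN finite_grid closed_cball)

lemma zero_in_layer: "0 \<in> layer d j"
proof -
  have "0 \<in> grid d j n" for n
    unfolding grid_def
    by (rule image_eqI[of _ _ "restrict (\<lambda>_. 0) {..<n}"]) (auto simp: grid_sum_def)
  then show ?thesis by (force simp: layer_def)
qed

lemma uminus_in_layer: "x \<in> layer d j \<Longrightarrow> - x \<in> layer d j"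
proof -
  assume x: "x \<in> layer d j"
  have "\<exists>p\<in>grid d j n. dist p (- x) \<le> 2 * real j / 2 ^ n\<^sup>2" for n
  proof -
    obtain p where p: "p \<in> grid d j n" "dist p x \<le> 2 * real j / 2 ^ n\<^sup>2"
      using x by (auto simp: layer_def)
    then obtain z where z: "z \<in> (\<Pi>\<^sub>E i\<in>{..<n}. {- int (j * digit_bound d i)..int (j * digit_bound d i)})"
      "p = grid_sum n z" by (auto simp: grid_def)
    have "- p = grid_sum n (restrict (\<lambda>i. - z i) {..<n})"
      by (simp add: z grid_sum_def sum_negf)
    moreover have "restrict (\<lambda>i. - z i) {..<n} \<in> (\<Pi>\<^sub>E i\<in>{..<n}. {- int (j * digit_bound d i)..int (j * digit_bound d i)})"
    proof (intro PiE_I)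
      fix i assume i: "i \<in> {..<n}"
      have "z i \<in> {- int (j * digit_bound d i)..int (j * digit_bound d i)}" using z(1) i by (rule PiE_mem)
      then show "restrict (\<lambda>i. - z i) {..<n} i \<in> {- int (j * digit_bound d i)..int (j * digit_bound d i)}"
        using i by simp
    qed auto
    ultimately have "- p \<in> grid d j n" unfolding grid_def by blast
    moreover have "dist (- p) (- x) \<le> 2 * real j / 2 ^ n\<^sup>2" using p(2) by (simp add: dist_minus)
    ultimately show ?thesis by blast
  qed
  then show ?thesis by (auto simp: layer_def)
qed

lemma add_in_layer: "x \<in> layer d j \<Longrightarrow> y \<in> layer d k \<Longrightarrow> x + y \<in> layer d (j + k)"
proof -
  assume x: "x \<in> layer d j" and y: "y \<in> layer d k"
  have "\<exists>p\<in>grid d (j + k) n. dist p (x + y) \<le> 2 * real (j + k) / 2 ^ n\<^sup>2" for n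
  proof -
    obtain p where p: "p \<in> grid d j n" "dist p x \<le> 2 * real j / 2 ^ n\<^sup>2"
      using x by (auto simp: layer_def)
    then obtain u where u: "u \<in> (\<Pi>\<^sub>E i\<in>{..<n}. {- int (j * digit_bound d i)..int (j * digit_bound d i)})"
      "p = grid_sum n u" by (auto simp: grid_def)
    obtain q where q: "q \<in> grid d k n" "dist q y \<le> 2 * real k / 2 ^ n\<^sup>2"
      using y by (auto simp: layer_def)
    then obtain v where v: "v \<in> (\<Pi>\<^sub>E i\<in>{..<n}. {- int (k * digit_bound d i)..int (k * digit_bound d i)})"
      "q = grid_sum n v" by (auto simp: grid_def)
    let ?z = "restrict (\<lambda>i. u i + v i) {..<n}"
    have "p + q = grid_sum n ?z"
      by (simp add: u v grid_sum_def sum.distrib add_divide_distrib)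
    moreover have "?z \<in> (\<Pi>\<^sub>E i\<in>{..<n}. {- int ((j + k) * digit_bound d i)..int ((j + k) * digit_bound d i)})"
    proof (intro PiE_I)
      fix i assume i: "i \<in> {..<n}"
      have "u i \<in> {- int (j * digit_bound d i)..int (j * digit_bound d i)}"
        "v i \<in> {- int (k * digit_bound d i)..int (k * digit_bound d i)}" using u v i by blast+
      then show "?z i \<in> {- int ((j + k) * digit_bound d i)..int ((j + k) * digit_bound d i)}"
        using i by (auto simp: algebra_simps)
    qed auto
    ultimately have "p + q \<in> grid d (j + k) n" unfolding grid_def by blast
    moreover have "dist (p + q) (x + y) \<le> 2 * real (j + k) / 2 ^ n\<^sup>2"
    proof -
      have "dist (p + q) (x + y) \<le> dist p x + dist q y" by (rule dist_triangle_add)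
      also have "\<dots> \<le> 2 * real j / 2 ^ n\<^sup>2 + 2 * real k / 2 ^ n\<^sup>2" using p q by (intro add_mono)
      finally show ?thesis by (simp add: add_divide_distrib algebra_simps)
    qed
    ultimately show ?thesis by blast
  qed
  then show ?thesis by (auto simp: layer_def)
qed

lemma digit_less_digit_bound: "digit (digit_bound d) x i < digit_bound d i"
  by (rule digit_less) (rule digit_bound_pos)

text \<open>
  The digits of \<open>x\<close> in the mixed radix \<open>digit_bound d\<close>, reused as coefficients of the sparser series. The map has a
  Hoelder continuous inverse of every exponent below \<open>d\<close>.
\<close>

definition spread :: "real \<Rightarrow> real \<Rightarrow> real" where
  "spread d x = (\<Sum>i. real (digit (digit_bound d) x i) / 2 ^ (Suc i)\<^sup>2)"

lemma spread_term_le: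
  assumes "0 \<le> d" "d < 1" and "k < digit_bound d i"
  shows "\<bar>of_int (int (digit (digit_bound d) x i) - int k) / 2 ^ (Suc i)\<^sup>2\<bar> \<le> (1 / 4 :: real) / 2 ^ i\<^sup>2"
proof -
  have "digit (digit_bound d) x i < digit_bound d i" by (rule digit_less_digit_bound)
  then have "\<bar>of_int (int (digit (digit_bound d) x i) - int k)\<bar> \<le> real (digit_bound d i) - 1"
    using assms(3) by simp
  also have "\<dots> \<le> 2 ^ (2 * i + 1) / 4" by (rule digit_bound_less[OF assms(1,2)])
  finally have "\<bar>of_int (int (digit (digit_bound d) x i) - int k)\<bar> / 2 ^ (Suc i)\<^sup>2 \<le> (2 ^ (2 * i + 1) / 4) / (2 :: real) ^ (Suc i)\<^sup>2"
    by (rule divide_right_mono) auto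
  also have "\<dots> = (1 / 4) / 2 ^ i\<^sup>2"
  proof -
    have "(Suc i)\<^sup>2 = i\<^sup>2 + (2 * i + 1)" by (simp add: power2_eq_square)
    then have "(2::real) ^ (Suc i)\<^sup>2 = 2 ^ i\<^sup>2 * 2 ^ (2 * i + 1)" by (simp only: power_add)
    then show ?thesis by (simp del: power_Suc add_Suc_right)
  qed
  finally show ?thesis by (simp add: abs_divide)
qed

lemma spread_in_layer:
  assumes "0 \<le> d" "d < 1"
  shows "spread d x \<in> layer d 1"
  unfolding layer_def
proof (intro INT_I)
  fix n
  let ?z = "restrict (\<lambda>i. int (digit (digit_bound d) x i)) {..<n}"
  have "grid_sum n ?z \<in> grid d 1 n" unfolding grid_def
  proof (intro imageI PiE_I)
    fix i assume "i \<in> {..<n}"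
    then have "?z i = int (digit (digit_bound d) x i)" by simp
    moreover have "int (digit (digit_bound d) x i) \<le> int (1 * digit_bound d i)"
      using digit_less_digit_bound[of d x i] by simp
    ultimately show "?z i \<in> {- int (1 * digit_bound d i)..int (1 * digit_bound d i)}" by simp
  qed (simp only: restrict_apply if_False)
  moreover have "dist (grid_sum n ?z) (spread d x) \<le> 2 * real 1 / 2 ^ n\<^sup>2"
  proof -
    let ?a = "\<lambda>i. real (digit (digit_bound d) x i) / 2 ^ (Suc i)\<^sup>2"
    have "\<bar>suminf ?a - (\<Sum>i<n. ?a i)\<bar> \<le> 2 * (1 / 4) / 2 ^ n\<^sup>2"
      using spread_term_le[OF assms digit_bound_pos] by (intro lacunary_tail) (auto simp: power_strict_mono)
    also have "\<dots> \<le> 2 * real 1 / 2 ^ n\<^sup>2" by (intro divide_right_mono) auto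
    finally show ?thesis by (simp add: grid_sum_def spread_def dist_real_def abs_minus_commute)
  qed
  ultimately show "spread d x \<in> (\<Union>p\<in>grid d 1 n. cball p (2 * real 1 / 2 ^ n\<^sup>2))" by auto
qed

text \<open>
  The terms after the first difference contribute at most half of what it contributes.
\<close>

lemma spread_separation:
  assumes d: "0 \<le> d" "d < 1"
    and eq: "\<And>i. i < n \<Longrightarrow> digit (digit_bound d) x i = digit (digit_bound d) y i"
    and ne: "digit (digit_bound d) x n \<noteq> digit (digit_bound d) y n"
  shows "1 / 2 / 2 ^ (Suc n)\<^sup>2 \<le> \<bar>spread d x - spread d y\<bar>"
proof -
  let ?d = "digit (digit_bound d)"
  let ?a = "\<lambda>x i. real (?d x i) / 2 ^ (Suc i)\<^sup>2"
  let ?b = "\<lambda>i. of_int (int (?d x i) - int (?d y i)) / 2 ^ (Suc i)\<^sup>2 :: real"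
  have sm: "summable (?a x)" for x
    using spread_term_le[OF d digit_bound_pos]
    by (intro lacunary_tail(1)[of "\<lambda>i. i\<^sup>2" 0 _ "1/4"]) (auto simp: power_strict_mono)
  have "spread d x - spread d y = suminf ?b"
    unfolding spread_def by (subst suminf_diff[OF sm sm]) (simp add: diff_divide_distrib)
  moreover have "(\<Sum>i<Suc n. ?b i) = ?b n" using eq by simp
  moreover have "\<bar>suminf ?b - (\<Sum>i<Suc n. ?b i)\<bar> \<le> 2 * (1 / 4) / 2 ^ (Suc n)\<^sup>2"
    using spread_term_le[OF d digit_less_digit_bound]
    by (intro lacunary_tail(2)[of "\<lambda>i. i\<^sup>2"]) (auto simp: power_strict_mono)
  moreover have "1 / 2 ^ (Suc n)\<^sup>2 \<le> \<bar>?b n\<bar>"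
  proof -
    have "1 \<le> \<bar>int (?d x n) - int (?d y n)\<bar>" using ne by linarith
    then have "(1::real) \<le> \<bar>of_int (int (?d x n) - int (?d y n))\<bar>" by linarith
    then show ?thesis by (simp add: abs_divide divide_right_mono)
  qed
  ultimately show ?thesis by linarith
qed

text \<open>
  Two points with equal digits below \<open>n\<close> have distance at most the reciprocal of the \<open>n\<close>-th radix product, which is
  about \<open>2 powr (- d n\<^sup>2)\<close>, while their images have distance about \<open>2 ^ (- (n + 1)\<^sup>2)\<close> or more.
\<close>

lemma hausdorff_measure_layer_pos:
  assumes d: "0 \<le> d" "d < 1" and s: "0 \<le> s" "s < d"
  shows "hausdorff_measure s (layer d 1) \<noteq> 0"
proof -
  let ?W = "radix_prod (digit_bound d)"
  let ?d = "digit (digit_bound d)"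
  define a b where "a = d - s" and "b = 2 + 2 * s"
  have "a > 0" using s by (simp add: a_def)
  \<comment> \<open>The quadratic \<open>b n - a n\<^sup>2\<close> is at most \<open>b\<^sup>2 / (4 a)\<close>; it collects the terms of the exponents that depend on \<open>n\<close>.\<close>
  define C where "C = 2 powr (b\<^sup>2 / (4 * a) + 2 * s)"
  have W: "1 / real (?W n) \<le> 2 powr (2 * real n - d * real (n\<^sup>2))" for n
  proof -
    have "(\<Prod>i<n. 2 powr (d * real (2 * i + 1)) / 4) \<le> (\<Prod>i<n. real (digit_bound d i))"
      using digit_bound_ge by (intro prod_mono) auto
    then have "2 powr (d * real (n\<^sup>2)) / 4 ^ n \<le> real (?W n)"
      by (simp only: prod_dividef prod_two_powr_odd prod_constant card_lessThan radix_prod_def of_nat_prod)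
    moreover have "0 < real (?W n)" using radix_prod_pos[of "digit_bound d" n] digit_bound_pos by simp
    ultimately have "1 / real (?W n) \<le> 1 / (2 powr (d * real (n\<^sup>2)) / 4 ^ n)"
      by (intro divide_left_mono mult_pos_pos divide_pos_pos) auto
    also have "\<dots> = 2 powr (2 * real n) / 2 powr (d * real (n\<^sup>2))"
    proof -
      have "2 powr (2 * real n) = (2 powr 2) powr real n" by (simp only: powr_powr)
      also have "\<dots> = 4 ^ n" by (simp add: powr_realpow)
      finally show ?thesis by simp
    qed
    also have "\<dots> = 2 powr (2 * real n - d * real (n\<^sup>2))" by (simp only: powr_diff)
    finally show ?thesis .
  qed
  have C: "1 / real (?W n) \<le> C * (1 / 2 / 2 ^ (Suc n)\<^sup>2) powr s" for n
  proof -
    have "1 / real (?W n) \<le> 2 powr (2 * real n - d * real (n\<^sup>2))" by (rule W)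
    also have "\<dots> \<le> 2 powr (b\<^sup>2 / (4 * a) + 2 * s - s * (1 + real ((Suc n)\<^sup>2)))"
    proof (rule powr_mono)
      have "0 \<le> a * (real n - b / (2 * a))\<^sup>2" using \<open>a > 0\<close> by simp
      also have "\<dots> = a * (real n)\<^sup>2 - b * real n + b\<^sup>2 / (4 * a)"
        using \<open>a > 0\<close> by (simp add: power2_eq_square field_simps)
      finally show "2 * real n - d * real (n\<^sup>2) \<le> b\<^sup>2 / (4 * a) + 2 * s - s * (1 + real ((Suc n)\<^sup>2))"
        by (simp add: a_def b_def power2_eq_square algebra_simps)
    qed simp
    also have "\<dots> = C * (1 / 2 / 2 ^ (Suc n)\<^sup>2) powr s"
    proof -
      have "(1 / 2 / 2 ^ (Suc n)\<^sup>2 :: real) = 1 / (2 powr 1 * 2 powr real ((Suc n)\<^sup>2))"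
        by (subst powr_realpow) simp_all
      also have "\<dots> = 2 powr (- (1 + real ((Suc n)\<^sup>2)))"
        by (simp only: powr_add powr_minus divide_inverse mult_1)
      finally have "(1 / 2 / 2 ^ (Suc n)\<^sup>2) powr s = 2 powr (- (1 + real ((Suc n)\<^sup>2)) * s)"
        by (simp only: powr_powr)
      then show ?thesis unfolding C_def by (simp only: powr_add[symmetric]) (simp add: algebra_simps)
    qed
    finally show ?thesis .
  qed
  have "0 < C" by (simp add: C_def)
  have "hausdorff_measure s (spread d ` {0..<1}) \<noteq> 0"
  proof (rule hausdorff_measure_pos_Holder_inverse[OF s(1) \<open>0 < C\<close>])
    fix x y :: real assume xy: "x \<in> {0..<1}" "y \<in> {0..<1}" "x < y"
    have "\<exists>n. ?d x n \<noteq> ?d y n"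
    proof (rule ccontr)
      assume "\<not> (\<exists>n. ?d x n \<noteq> ?d y n)"
      then have "\<bar>x - y\<bar> < 1 / real (?W k)" for k
        using abs_diff_less_if_digits_eq[of "digit_bound d" x y k] digit_bound_pos xy by auto
      then have "\<bar>x - y\<bar> \<le> 2 powr (2 * real k - d * real (k\<^sup>2))" for k
        using W[of k] by (meson less_imp_le order_trans)
      moreover have "(\<lambda>k. 2 powr (2 * real k - d * real (k\<^sup>2))) \<longlonglongrightarrow> 0"
        using s by real_asymp
      ultimately have "\<bar>x - y\<bar> \<le> 0" by (intro LIMSEQ_le_const) auto
      then show False using xy by simp
    qed
    define n where "n = (LEAST n. ?d x n \<noteq> ?d y n)"
    have n: "?d x n \<noteq> ?d y n" "\<And>i. i < n \<Longrightarrow> ?d x i = ?d y i"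
      using LeastI_ex[OF \<open>\<exists>n. ?d x n \<noteq> ?d y n\<close>] not_less_Least unfolding n_def by blast+
    have sep: "1 / 2 / 2 ^ (Suc n)\<^sup>2 \<le> \<bar>spread d x - spread d y\<bar>"
      using spread_separation[OF d n(2) n(1)] .
    have "\<bar>x - y\<bar> \<le> 1 / real (?W n)"
      using abs_diff_less_if_digits_eq[of "digit_bound d" x y n] digit_bound_pos xy n by auto
    also have "\<dots> \<le> C * (1 / 2 / 2 ^ (Suc n)\<^sup>2) powr s" by (rule C)
    also have "\<dots> \<le> C * \<bar>spread d x - spread d y\<bar> powr s"
      using sep \<open>0 < C\<close> s by (intro mult_left_mono powr_mono2) auto
    finally show "spread d x \<noteq> spread d y \<and> \<bar>x - y\<bar> \<le> C * \<bar>spread d x - spread d y\<bar> powr s"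
      using sep by (auto simp: field_simps intro: ccontr)
  qed
  moreover have "spread d ` {0..<1} \<subseteq> layer d 1" using spread_in_layer[OF d] by auto
  ultimately show ?thesis using hausdorff_measure_mono[of "spread d ` {0..<1}" "layer d 1" s] by auto
qed

section \<open>A compact family whose integer combinations degenerate\<close>

text \<open>
  The pieces of stage \<open>k\<close> have length \<open>2 ^ (- (level k)\<^sup>2)\<close>. The recursion bounds their number
  by \<open>2 ^ level (Suc k)\<close>, which is negligible against every negative power of the length of the next pieces; the summand 2 makes
  \<open>gap\<close> strictly increasing from the start.
\<close>

primrec level :: "nat \<Rightarrow> nat" where
  "level 0 = 0"
| "level (Suc k) = (level k)\<^sup>2 + 2"

text \<open>
  The exponent \<open>(level k)\<^sup>2 - level k\<close>: slopes of size up to \<open>2 ^ level k\<close> enlarge an error of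
  size \<open>2 ^ (- (level k)\<^sup>2)\<close> to at most \<open>2 ^ (- gap k)\<close>.
\<close>

definition gap :: "nat \<Rightarrow> nat" where
  "gap k = level k * (level k - 1)"

definition radix :: "nat \<Rightarrow> nat" where
  "radix i = 2 ^ ((level (Suc i))\<^sup>2 - (level i)\<^sup>2)"

definition codes :: "(nat \<Rightarrow> nat) set" where
  "codes = {\<omega>. \<forall>i. \<omega> i < radix i}"

text \<open>
  A table is a length \<open>l\<close> together with a list of pairs of a digit block of length \<open>l\<close> and the two integers assigned to it. The
  second component of \<open>prod_decode k\<close> is free, so that every table occurs at infinitely many stages.
\<close>

definition stage :: "nat \<Rightarrow> nat \<times> (nat list \<times> int \<times> int) list" where
  "stage k = from_nat (fst (prod_decode k))"

text \<open>
  The slope of \<open>b\<close> for which \<open>m x + (n - m \<xi>) b(x)\<close> is constant. If \<open>m = n = 0\<close> then the division by zero gives 0, which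
  serves as well.
\<close>

definition killing_slope :: "real \<Rightarrow> int \<Rightarrow> int \<Rightarrow> real" where
  "killing_slope \<xi> m n = of_int m / (of_int m * \<xi> - of_int n)"

text \<open>
  The slope of \<open>b\<close> at stage \<open>k\<close>. It depends only on the digits before \<open>k\<close>, that is, on the piece of stage \<open>k\<close>.
  Slopes that are too steep for the current stage are skipped; every table is
  used again at later stages, which admit them.
\<close>

definition slope :: "real \<Rightarrow> nat \<Rightarrow> (nat \<Rightarrow> nat) \<Rightarrow> real" where
  "slope \<xi> k \<omega> =
     (case stage k of (l, tab) \<Rightarrow>
        if l \<le> k then
          (case map_of tab (map \<omega> [0..<l]) of
             None \<Rightarrow> 0
           | Some (m, n) \<Rightarrow> if \<bar>killing_slope \<xi> m n\<bar> \<le> 2 ^ level k then killing_slope \<xi> m n else 0)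
        else 0)"

definition code_term :: "real \<Rightarrow> real \<Rightarrow> real \<Rightarrow> (nat \<Rightarrow> nat) \<Rightarrow> nat \<Rightarrow> real" where
  "code_term \<xi> p q \<omega> i = (p + q * slope \<xi> i \<omega>) * real (\<omega> i) / 2 ^ (level (Suc i))\<^sup>2"

text \<open>
  The number \<open>p x + q b(x)\<close>, where \<open>x\<close> is the point with digit sequence \<open>\<omega>\<close>. Thus \<open>x\<close>, \<open>b\<close> and
  \<open>a\<close> are the values for \<open>(p, q) = (1, 0)\<close>, \<open>(0, 1)\<close> and \<open>(1, - \<xi>)\<close>.
\<close>

definition code_value :: "real \<Rightarrow> real \<Rightarrow> real \<Rightarrow> (nat \<Rightarrow> nat) \<Rightarrow> real" where
  "code_value \<xi> p q \<omega> = suminf (code_term \<xi> p q \<omega>)"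

lemma level_less_Suc: "level k < level (Suc k)"
  by (cases "level k") (auto simp: power2_eq_square)

lemma le_level: "k \<le> level k"
  by (induction k) (use level_less_Suc in \<open>auto intro: Suc_leI le_less_trans simp del: level.simps(2)\<close>)

lemma level_power2_mono: "(level k)\<^sup>2 \<le> (level (Suc k))\<^sup>2"
  using level_less_Suc[of k] by (intro power_mono) auto

lemma gap_less_Suc: "gap k < gap (Suc k)"
proof -
  have "gap k \<le> level k * (level (Suc k) - 1)"
    unfolding gap_def using level_less_Suc[of k] by (intro mult_left_mono) auto
  also have "\<dots> < gap (Suc k)"
    unfolding gap_def using level_less_Suc[of k] by (intro mult_strict_right_mono) auto
  finally show ?thesis .
qed

lemma level_power2: "(level k)\<^sup>2 = level k + gap k"
  by (cases "level k") (auto simp: gap_def power2_eq_square)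

lemma radix_pos: "0 < radix i"
  by (simp add: radix_def)

lemma two_powr_level_Suc: "(2 :: nat) ^ (level (Suc i))\<^sup>2 = radix i * 2 ^ (level i)\<^sup>2"
  using level_power2_mono[of i] unfolding radix_def by (simp only: power_add[symmetric] le_add_diff_inverse2)

lemma radix_prod_radix: "radix_prod radix k = 2 ^ (level k)\<^sup>2"
proof (induction k)
  case (Suc k)
  then show ?case by (simp only: radix_prod_Suc two_powr_level_Suc)
qed simp

lemma slope_cong:
  assumes "\<And>i. i < k \<Longrightarrow> \<omega> i = \<omega>' i"
  shows "slope \<xi> k \<omega> = slope \<xi> k \<omega>'"
proof -
  obtain l tab where st: "stage k = (l, tab)" by force
  show ?thesis
  proof (cases "l \<le> k")
    case True
    then have *: "map \<omega> [0..<l] = map \<omega>' [0..<l]" using assms by auto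
    show ?thesis unfolding slope_def st prod.case * ..
  qed (simp add: slope_def st)
qed

lemma abs_slope_le: "\<bar>slope \<xi> k \<omega>\<bar> \<le> 2 ^ level k"
  by (auto simp: slope_def split: prod.splits option.splits)

text \<open>
  This is where the irrationality of \<open>\<xi>\<close> enters: \<open>n = m \<xi>\<close> is possible only for \<open>m = n = 0\<close>.
\<close>

lemma slope_kills:
  assumes "\<xi> \<notin> \<rat>" "stage k = (l, tab)" "l \<le> k" "map_of tab (map \<omega> [0..<l]) = Some (m, n)"
    and "\<bar>killing_slope \<xi> m n\<bar> \<le> 2 ^ level k"
  shows "of_int m + (of_int n - of_int m * \<xi>) * slope \<xi> k \<omega> = 0"
proof (cases "of_int n = of_int m * \<xi>")
  case True
  have "m = 0"
  proof (rule ccontr)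
    assume "m \<noteq> 0"
    then have "\<xi> = of_int n / of_int m" using True by simp
    then show False using assms(1) by simp
  qed
  then show ?thesis using True by simp
next
  case False
  have "slope \<xi> k \<omega> = killing_slope \<xi> m n" using assms by (simp add: slope_def)
  then show ?thesis using False by (simp add: killing_slope_def field_simps)
qed

lemma stage_infinitely_often: "\<exists>k\<ge>K. stage k = h"
  by (rule exI[of _ "prod_encode (to_nat h, K)"]) (simp add: stage_def le_prod_encode_2)

lemma abs_code_term_le:
  assumes "\<omega> \<in> codes"
  shows "\<bar>code_term \<xi> p q \<omega> i\<bar> \<le> (\<bar>p\<bar> + \<bar>q\<bar>) / 2 ^ gap i"
proof -
  have "\<bar>p + q * slope \<xi> i \<omega>\<bar> \<le> \<bar>p\<bar> * 1 + \<bar>q\<bar> * \<bar>slope \<xi> i \<omega>\<bar>"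
    using abs_triangle_ineq[of p "q * slope \<xi> i \<omega>"] by (simp add: abs_mult)
  also have "\<dots> \<le> \<bar>p\<bar> * 2 ^ level i + \<bar>q\<bar> * 2 ^ level i"
    by (intro add_mono mult_left_mono abs_slope_le) auto
  finally have 1: "\<bar>p + q * slope \<xi> i \<omega>\<bar> \<le> (\<bar>p\<bar> + \<bar>q\<bar>) * 2 ^ level i" by (simp add: algebra_simps)
  have 2: "real (\<omega> i) \<le> real (radix i)" using assms by (auto simp: codes_def less_imp_le)
  have 3: "(2::real) ^ (level (Suc i))\<^sup>2 = real (radix i) * (2 ^ level i * 2 ^ gap i)"
    using arg_cong[OF two_powr_level_Suc, of real i] by (simp only: of_nat_mult of_nat_power of_nat_numeral level_power2[of i] power_add)
  have "\<bar>code_term \<xi> p q \<omega> i\<bar> = \<bar>p + q * slope \<xi> i \<omega>\<bar> * real (\<omega> i) / 2 ^ (level (Suc i))\<^sup>2"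
    unfolding code_term_def by (simp only: abs_mult abs_divide abs_of_nat) simp
  also have "\<dots> \<le> (\<bar>p\<bar> + \<bar>q\<bar>) * 2 ^ level i * real (radix i) / 2 ^ (level (Suc i))\<^sup>2"
    using 1 2 by (intro divide_right_mono mult_mono) auto
  also have "\<dots> = (\<bar>p\<bar> + \<bar>q\<bar>) / 2 ^ gap i" unfolding 3 using radix_pos[of i] by simp
  finally show ?thesis .
qed

lemma summable_code_term: "\<omega> \<in> codes \<Longrightarrow> summable (code_term \<xi> p q \<omega>)"
  by (rule lacunary_tail(1)[of gap 0 _ "\<bar>p\<bar> + \<bar>q\<bar>"]) (auto simp: gap_less_Suc abs_code_term_le)

lemma code_value_tail:
  "\<omega> \<in> codes \<Longrightarrow> \<bar>code_value \<xi> p q \<omega> - (\<Sum>i<n. code_term \<xi> p q \<omega> i)\<bar> \<le> 2 * (\<bar>p\<bar> + \<bar>q\<bar>) / 2 ^ gap n"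
  unfolding code_value_def by (rule lacunary_tail(2)) (auto simp: gap_less_Suc abs_code_term_le)

lemma code_value_linear:
  assumes "\<omega> \<in> codes"
  shows "code_value \<xi> (p + c * p') (q + c * q') \<omega> = code_value \<xi> p q \<omega> + c * code_value \<xi> p' q' \<omega>"
proof -
  note s = summable_code_term[OF assms, of \<xi>]
  have "code_term \<xi> (p + c * p') (q + c * q') \<omega> i = code_term \<xi> p q \<omega> i + c * code_term \<xi> p' q' \<omega> i" for i
    by (simp add: code_term_def add_divide_distrib[symmetric] algebra_simps)
  then have "code_term \<xi> (p + c * p') (q + c * q') \<omega> = (\<lambda>i. code_term \<xi> p q \<omega> i + c * code_term \<xi> p' q' \<omega> i)" ..
  then have "code_value \<xi> (p + c * p') (q + c * q') \<omega> = (\<Sum>i. code_term \<xi> p q \<omega> i + c * code_term \<xi> p' q' \<omega> i)"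
    by (simp add: code_value_def)
  also have "\<dots> = code_value \<xi> p q \<omega> + c * code_value \<xi> p' q' \<omega>"
    unfolding code_value_def using s by (simp add: suminf_add[symmetric] suminf_mult summable_mult)
  finally show ?thesis .
qed

lemma sum_code_term_cong:
  assumes "\<And>i. i < k \<Longrightarrow> \<omega> i = \<omega>' i"
  shows "(\<Sum>i<k. code_term \<xi> p q \<omega> i) = (\<Sum>i<k. code_term \<xi> p q \<omega>' i)"
proof (rule sum.cong)
  fix i assume "i \<in> {..<k}"
  then show "code_term \<xi> p q \<omega> i = code_term \<xi> p q \<omega>' i"
    using slope_cong[of i \<omega> \<omega>' \<xi>] assms by (simp add: code_term_def)
qed simp

lemma compact_codes: "compact codes"
proof -
  have "codes = PiE UNIV (\<lambda>i. {..<radix i})" by (auto simp: codes_def PiE_iff)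
  moreover have "compactin (product_topology (\<lambda>_. euclidean) UNIV) (PiE UNIV (\<lambda>i. {..<radix i}))"
    by (auto simp: compactin_PiE intro: finite_imp_compact)
  ultimately show ?thesis by (simp add: euclidean_product_topology)
qed

text \<open>
  Codes that agree on a long prefix have close values by \<open>code_value_tail\<close>, and fixing a prefix is an open condition
  in the product topology.
\<close>

lemma continuous_on_code_value: "continuous_on codes (code_value \<xi> p q)"
  unfolding continuous_on_topological
proof (intro ballI allI impI)
  fix \<omega> B assume \<omega>: "\<omega> \<in> codes" and B: "open B" "code_value \<xi> p q \<omega> \<in> B"
  obtain e where e: "e > 0" "ball (code_value \<xi> p q \<omega>) e \<subseteq> B" using B openE by blast
  let ?c = "\<bar>p\<bar> + \<bar>q\<bar>"
  obtain k :: nat where k: "4 * ?c / e < real k" using reals_Archimedean2 by blast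
  have "real k < 2 ^ gap k"
  proof -
    have "k \<le> gap k" by (rule strict_mono_imp_increasing) (simp add: strict_mono_Suc_iff gap_less_Suc)
    also have "gap k < 2 ^ gap k" by simp
    finally show ?thesis by (metis of_nat_less_numeral_power_cancel_iff)
  qed
  then have "4 * ?c / e < 2 ^ gap k" using k by linarith
  then have small: "4 * ?c / 2 ^ gap k < e" using e by (simp add: field_simps)
  let ?A = "PiE UNIV (\<lambda>i. if i < k then {\<omega> i} else UNIV)"
  have "open ?A"
  proof (rule open_PiE)
    show "finite {i. (if i < k then {\<omega> i} else UNIV) \<noteq> UNIV}"
      by (rule finite_subset[of _ "{..<k}"]) auto
  qed (auto intro: open_discrete)
  moreover have "\<omega> \<in> ?A" by auto
  moreover have "code_value \<xi> p q \<omega>' \<in> B" if \<omega>': "\<omega>' \<in> codes" "\<omega>' \<in> ?A" for \<omega>'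
  proof -
    have "\<omega>' i = \<omega> i" if "i < k" for i using PiE_mem[OF \<omega>'(2), of i] that by simp
    then have "(\<Sum>i<k. code_term \<xi> p q \<omega>' i) = (\<Sum>i<k. code_term \<xi> p q \<omega> i)"
      by (rule sum_code_term_cong)
    then have "\<bar>code_value \<xi> p q \<omega> - code_value \<xi> p q \<omega>'\<bar> \<le> 2 * ?c / 2 ^ gap k + 2 * ?c / 2 ^ gap k"
      using code_value_tail[OF \<omega>, of \<xi> p q k] code_value_tail[OF \<omega>'(1), of \<xi> p q k] by linarith
    then have "\<bar>code_value \<xi> p q \<omega> - code_value \<xi> p q \<omega>'\<bar> < e" using small by simp
    then show ?thesis using e(2) by (auto simp: dist_real_def)
  qed
  ultimately show "\<exists>A. open A \<and> \<omega> \<in> A \<and> (\<forall>y\<in>codes. y \<in> A \<longrightarrow> code_value \<xi> p q y \<in> B)" by blast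
qed

definition cylinder :: "nat \<Rightarrow> nat list \<Rightarrow> (nat \<Rightarrow> nat) set" where
  "cylinder l u = {\<omega> \<in> codes. map \<omega> [0..<l] = u}"

text \<open>
  The number \<open>m a + n b\<close> at the point with digit sequence \<open>\<omega>\<close>.
\<close>

definition combination :: "real \<Rightarrow> int \<Rightarrow> int \<Rightarrow> (nat \<Rightarrow> nat) \<Rightarrow> real" where
  "combination \<xi> m n = code_value \<xi> (of_int m) (of_int n - of_int m * \<xi>)"

text \<open>
  The digits before \<open>k\<close> take at most \<open>2 ^ (level k)\<^sup>2\<close> values, the digit at \<open>k\<close> contributes nothing, and the
  later digits contribute only at the scale of the next stage.
\<close>

lemma coverable_combination_cylinder:
  assumes "\<xi> \<notin> \<rat>" "stage k = (l, tab)" "l \<le> k" "map_of tab u = Some (m, n)"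
    and "\<bar>killing_slope \<xi> m n\<bar> \<le> 2 ^ level k"
  shows "coverable (2 ^ (level k)\<^sup>2)
    (2 * (\<bar>of_int m\<bar> + \<bar>of_int n - of_int m * \<xi>\<bar>) / 2 ^ gap (Suc k)) (combination \<xi> m n ` cylinder l u)"
proof -
  let ?p = "of_int m :: real" and ?q = "of_int n - of_int m * \<xi>"
  let ?S = "\<lambda>\<omega>. \<Sum>i<k. code_term \<xi> ?p ?q \<omega> i"
  let ?R = "PiE {..<k} (\<lambda>i. {..<radix i})"
  have fin: "finite ?R" by (intro finite_PiE) auto
  have "card (?S ` ?R) \<le> card ?R" using fin by (rule card_image_le)
  also have "\<dots> = 2 ^ (level k)\<^sup>2"
    by (simp only: card_PiE finite_lessThan card_lessThan radix_prod_def[symmetric] radix_prod_radix)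
  finally have "real (card (?S ` ?R)) \<le> 2 ^ (level k)\<^sup>2"
    using of_nat_mono by fastforce
  moreover have "combination \<xi> m n ` cylinder l u \<subseteq> (\<Union>p\<in>?S ` ?R. cball p (2 * (\<bar>?p\<bar> + \<bar>?q\<bar>) / 2 ^ gap (Suc k)))"
  proof
    fix x assume "x \<in> combination \<xi> m n ` cylinder l u"
    then obtain \<omega> where \<omega>: "\<omega> \<in> codes" "map \<omega> [0..<l] = u" "x = code_value \<xi> ?p ?q \<omega>"
      by (auto simp: cylinder_def combination_def)
    have "code_term \<xi> ?p ?q \<omega> k = 0"
      using slope_kills[OF assms(1,2,3), of \<omega> m n] assms \<omega> by (simp add: code_term_def)
    then have "\<bar>x - ?S \<omega>\<bar> \<le> 2 * (\<bar>?p\<bar> + \<bar>?q\<bar>) / 2 ^ gap (Suc k)"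
      using code_value_tail[OF \<omega>(1), of \<xi> ?p ?q "Suc k"] \<omega>(3) by simp
    moreover have "?S \<omega> = ?S (restrict \<omega> {..<k})" by (rule sum_code_term_cong) simp
    moreover have "restrict \<omega> {..<k} \<in> ?R" using \<omega>(1) by (auto simp: codes_def)
    ultimately show "x \<in> (\<Union>p\<in>?S ` ?R. cball p (2 * (\<bar>?p\<bar> + \<bar>?q\<bar>) / 2 ^ gap (Suc k)))"
      by (intro UN_I[of "?S (restrict \<omega> {..<k})"]) (auto simp: dist_real_def abs_minus_commute)
  qed
  ultimately show ?thesis by (rule coverableI[OF finite_imageI[OF fin]])
qed

text \<open>
  Sums with prescribed coefficients and arbitrary codes; all lists together give the group generated
  by the values of \<open>a\<close> and \<open>b\<close>.
\<close>

fun combinations :: "real \<Rightarrow> (int \<times> int) list \<Rightarrow> real set" where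
  "combinations \<xi> [] = {0}"
| "combinations \<xi> ((m, n) # L) = combination \<xi> m n ` codes + combinations \<xi> L"

text \<open>
  The same sums, with every code confined to the cylinder that a table assigns to its coefficients.
\<close>

fun table_sums :: "real \<Rightarrow> nat \<Rightarrow> (nat list \<times> int \<times> int) list \<Rightarrow> real set" where
  "table_sums \<xi> l [] = {0}"
| "table_sums \<xi> l ((u, m, n) # tab) = combination \<xi> m n ` cylinder l u + table_sums \<xi> l tab"

lemma compact_combinations: "compact (combinations \<xi> L)"
proof (induction \<xi> L rule: combinations.induct)
  case (2 \<xi> m n L)
  have "compact (combination \<xi> m n ` codes)"
    unfolding combination_def by (intro compact_continuous_image continuous_on_code_value compact_codes)
  moreover have "combinations \<xi> ((m, n) # L)
      = {x + y |x y. x \<in> combination \<xi> m n ` codes \<and> y \<in> combinations \<xi> L}"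
    unfolding combinations.simps set_plus_def by blast
  ultimately show ?case using compact_sums[OF _ 2] by simp
qed simp

lemma combinations_append: "combinations \<xi> (L @ L') = combinations \<xi> L + combinations \<xi> L'"
proof (induction \<xi> L rule: combinations.induct)
  case (1 \<xi>)
  show ?case by (simp add: set_plus_def)
next
  case (2 \<xi> m n L)
  then show ?case by (simp only: append_Cons combinations.simps add.assoc)
qed

lemma combination_add:
  "\<omega> \<in> codes \<Longrightarrow> combination \<xi> (m + m') (n + n') \<omega> = combination \<xi> m n \<omega> + combination \<xi> m' n' \<omega>"
proof -
  assume \<omega>: "\<omega> \<in> codes"
  have eq1: "of_int (n + n') - of_int (m + m') * \<xi>
      = (of_int n - of_int m * \<xi>) + 1 * (of_int n' - of_int m' * \<xi>)"
    and eq2: "of_int (m + m') = of_int m + 1 * (of_int m' :: real)"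
    by (simp_all add: algebra_simps)
  show ?thesis
    unfolding combination_def by (subst eq1, subst eq2, subst code_value_linear[OF \<omega>]) simp
qed

lemma combination_0 [simp]: "combination \<xi> 0 0 \<omega> = 0"
  by (simp add: combination_def code_value_def code_term_def[abs_def])

lemma combination_minus: "\<omega> \<in> codes \<Longrightarrow> combination \<xi> (- m) (- n) \<omega> = - combination \<xi> m n \<omega>"
  using combination_add[of \<omega> \<xi> m "- m" n "- n"] by simp

lemma uminus_combinations: "x \<in> combinations \<xi> L \<Longrightarrow> - x \<in> combinations \<xi> (map (\<lambda>(m, n). (- m, - n)) L)"
proof (induction \<xi> L arbitrary: x rule: combinations.induct)
  case (2 \<xi> m n L)
  then obtain \<omega> y where "x = combination \<xi> m n \<omega> + y" "\<omega> \<in> codes" "y \<in> combinations \<xi> L"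
    by (auto simp: set_plus_def)
  moreover from this have "- x = combination \<xi> (- m) (- n) \<omega> + - y" by (simp add: combination_minus)
  moreover have "- y \<in> combinations \<xi> (map (\<lambda>(m, n). (- m, - n)) L)" using calculation 2(1) by blast
  ultimately show ?case
    unfolding list.map prod.case combinations.simps by (metis imageI set_plus_intro)
qed simp

text \<open>
  Terms with the same code are merged. This matters because one piece can have only one slope.
\<close>

lemma combinations_distinct_codes:
  "x \<in> combinations \<xi> L \<Longrightarrow> \<exists>F m n. finite F \<and> F \<subseteq> codes \<and> x = (\<Sum>\<omega>\<in>F. combination \<xi> (m \<omega>) (n \<omega>) \<omega>)"
proof (induction \<xi> L arbitrary: x rule: combinations.induct)
  case (1 \<xi>)
  then show ?case by (intro exI[of _ "{}"]) auto
next
  case (2 \<xi> m' n' L)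
  then obtain \<omega>' y where x: "x = combination \<xi> m' n' \<omega>' + y" "\<omega>' \<in> codes" "y \<in> combinations \<xi> L"
    by (auto simp: set_plus_def)
  with 2 obtain F m n where F: "finite F" "F \<subseteq> codes" "y = (\<Sum>\<omega>\<in>F. combination \<xi> (m \<omega>) (n \<omega>) \<omega>)" by blast
  define m1 where "m1 \<omega> = (if \<omega> \<in> F then m \<omega> else 0) + (if \<omega> = \<omega>' then m' else 0)" for \<omega>
  define n1 where "n1 \<omega> = (if \<omega> \<in> F then n \<omega> else 0) + (if \<omega> = \<omega>' then n' else 0)" for \<omega>
  let ?G = "insert \<omega>' F"
  have "(\<Sum>\<omega>\<in>?G. combination \<xi> (m1 \<omega>) (n1 \<omega>) \<omega>)
      = (\<Sum>\<omega>\<in>?G. combination \<xi> (if \<omega> \<in> F then m \<omega> else 0) (if \<omega> \<in> F then n \<omega> else 0) \<omega>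
          + combination \<xi> (if \<omega> = \<omega>' then m' else 0) (if \<omega> = \<omega>' then n' else 0) \<omega>)"
    unfolding m1_def n1_def using F x by (intro sum.cong combination_add) auto
  also have "\<dots> = (\<Sum>\<omega>\<in>?G. if \<omega> \<in> F then combination \<xi> (m \<omega>) (n \<omega>) \<omega> else 0)
      + (\<Sum>\<omega>\<in>?G. if \<omega> = \<omega>' then combination \<xi> m' n' \<omega> else 0)"
    unfolding sum.distrib by (intro arg_cong2[of _ _ _ _ "(+)"] sum.cong) auto
  also have "(\<Sum>\<omega>\<in>?G. if \<omega> \<in> F then combination \<xi> (m \<omega>) (n \<omega>) \<omega> else 0) = y"
    unfolding F(3) using F(1) by (intro sum.mono_neutral_cong_right) auto
  also have "(\<Sum>\<omega>\<in>?G. if \<omega> = \<omega>' then combination \<xi> m' n' \<omega> else 0) = combination \<xi> m' n' \<omega>'"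
    using F(1) by simp
  finally have "x = (\<Sum>\<omega>\<in>?G. combination \<xi> (m1 \<omega>) (n1 \<omega>) \<omega>)" using x by simp
  then show ?case using F x by (intro exI[of _ ?G] exI[of _ m1] exI[of _ n1]) auto
qed

lemma separating_prefix_length:
  fixes F :: "(nat \<Rightarrow> nat) set"
  assumes "finite F"
  shows "\<exists>l. inj_on (\<lambda>\<omega>. map \<omega> [0..<l]) F"
proof -
  define \<delta> where "\<delta> \<omega> \<omega>' = (LEAST i. \<omega> i \<noteq> \<omega>' i)" for \<omega> \<omega>' :: "nat \<Rightarrow> nat"
  define l where "l = Suc (Max ((\<lambda>(\<omega>, \<omega>'). \<delta> \<omega> \<omega>') ` (F \<times> F)))"
  have "inj_on (\<lambda>\<omega>. map \<omega> [0..<l]) F"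
  proof (rule inj_onI, rule ccontr)
    fix \<omega> \<omega>' assume w: "\<omega> \<in> F" "\<omega>' \<in> F" "map \<omega> [0..<l] = map \<omega>' [0..<l]" "\<omega> \<noteq> \<omega>'"
    have "\<omega> (\<delta> \<omega> \<omega>') \<noteq> \<omega>' (\<delta> \<omega> \<omega>')" unfolding \<delta>_def by (rule LeastI_ex) (use w(4) in auto)
    moreover have "\<delta> \<omega> \<omega>' \<le> Max ((\<lambda>(\<omega>, \<omega>'). \<delta> \<omega> \<omega>') ` (F \<times> F))"
      using assms w by (intro Max_ge) auto
    then have "\<delta> \<omega> \<omega>' < l" by (simp add: l_def)
    ultimately show False using w(3) by (auto simp: map_eq_conv)
  qed
  then show ?thesis by blast
qed

text \<open>
  Distinct codes are separated by their prefixes of some common length; these prefixes form a table.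
\<close>

lemma combinations_subset_table_sums:
  assumes "x \<in> combinations \<xi> L"
  shows "\<exists>l tab. distinct (map fst tab) \<and> x \<in> table_sums \<xi> l tab"
proof -
  obtain F m n where F: "finite F" "F \<subseteq> codes" "x = (\<Sum>\<omega>\<in>F. combination \<xi> (m \<omega>) (n \<omega>) \<omega>)"
    using combinations_distinct_codes[OF assms] by blast
  obtain l where l: "inj_on (\<lambda>\<omega>. map \<omega> [0..<l]) F" using separating_prefix_length[OF F(1)] by blast
  obtain fs where fs: "set fs = F" "distinct fs" using finite_distinct_list[OF F(1)] by blast
  let ?tab = "map (\<lambda>\<omega>. (map \<omega> [0..<l], m \<omega>, n \<omega>))"
  have "set gs \<subseteq> codes \<Longrightarrow> (\<Sum>\<omega>\<leftarrow>gs. combination \<xi> (m \<omega>) (n \<omega>) \<omega>) \<in> table_sums \<xi> l (?tab gs)" for gs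
    by (induction gs) (auto intro!: set_plus_intro simp: cylinder_def)
  then have "(\<Sum>\<omega>\<leftarrow>fs. combination \<xi> (m \<omega>) (n \<omega>) \<omega>) \<in> table_sums \<xi> l (?tab fs)" using F(2) fs(1) by blast
  then have "x \<in> table_sums \<xi> l (?tab fs)"
    unfolding F(3) fs(1)[symmetric] by (simp only: sum.distinct_set_conv_list[OF fs(2)])
  moreover have "map fst (?tab fs) = map (\<lambda>\<omega>. map \<omega> [0..<l]) fs" by simp
  then have "distinct (map fst (?tab fs))" using l fs by (simp only: distinct_map)
  ultimately show ?thesis by blast
qed

text \<open>
  At a stage that uses the table, all terms degenerate at once. The induction runs over a sublist since
  the slopes of the stage are those of the whole table.
\<close>

lemma coverable_table_sums:
  assumes "\<xi> \<notin> \<rat>" "stage k = (l, tab)" "l \<le> k" "distinct (map fst tab)"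
    and "\<And>u m n. (u, m, n) \<in> set tab \<Longrightarrow> \<bar>killing_slope \<xi> m n\<bar> \<le> 2 ^ level k"
    and "set sub \<subseteq> set tab"
  shows "coverable ((2 ^ (level k)\<^sup>2) ^ length sub)
    ((\<Sum>(u, m, n)\<leftarrow>sub. 2 * (\<bar>of_int m\<bar> + \<bar>of_int n - of_int m * \<xi>\<bar>)) / 2 ^ gap (Suc k)) (table_sums \<xi> l sub)"
  using assms(6)
proof (induction sub)
  case Nil
  show ?case by (simp, rule coverableI[of "{0}"]) auto
next
  case (Cons e sub)
  obtain u m n where e: "e = (u, m, n)" by (cases e)
  have "map_of tab u = Some (m, n)" using Cons.prems assms(4) e by simp
  then have "coverable (2 ^ (level k)\<^sup>2)
    (2 * (\<bar>of_int m\<bar> + \<bar>of_int n - of_int m * \<xi>\<bar>) / 2 ^ gap (Suc k)) (combination \<xi> m n ` cylinder l u)"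
    using Cons.prems e by (intro coverable_combination_cylinder[OF assms(1-3)] assms(5)) auto
  moreover have "coverable ((2 ^ (level k)\<^sup>2) ^ length sub)
    ((\<Sum>(u, m, n)\<leftarrow>sub. 2 * (\<bar>of_int m\<bar> + \<bar>of_int n - of_int m * \<xi>\<bar>)) / 2 ^ gap (Suc k)) (table_sums \<xi> l sub)"
    using Cons by simp
  ultimately show ?case
    unfolding e list.map sum_list.Cons prod.case table_sums.simps length_Cons power_Suc add_divide_distrib
    by (rule coverable_plus)
qed

section \<open>The group\<close>

lemma codes_represent:
  assumes "x \<in> {0..<1}"
  shows "digit radix x \<in> codes" "code_value \<xi> 1 0 (digit radix x) = x"
proof -
  show "digit radix x \<in> codes" by (auto simp: codes_def intro: digit_less radix_pos)
  have "real k \<le> real (radix_prod radix k)" for k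
  proof -
    have "k \<le> level k" by (rule le_level)
    also have "\<dots> \<le> (level k)\<^sup>2" by (simp add: power2_eq_square)
    also have "\<dots> \<le> 2 ^ (level k)\<^sup>2" by (simp add: less_imp_le)
    finally show ?thesis unfolding radix_prod_radix by (rule of_nat_mono)
  qed
  then have "(\<lambda>i. real (digit radix x i) / real (radix_prod radix (Suc i))) sums x"
    by (intro digits_sums radix_pos assms)
  then show "code_value \<xi> 1 0 (digit radix x) = x"
    unfolding code_value_def code_term_def[abs_def] radix_prod_radix by (simp add: sums_iff)
qed

lemma measurable_code_value_digit: "(\<lambda>x. code_value \<xi> p q (digit radix x)) \<in> borel_measurable borel"
proof -
  have "(\<lambda>x. slope \<xi> i (digit radix x)) \<in> borel_measurable borel" for i
  proof -
    have "slope \<xi> i (digit radix x) = slope \<xi> i ((!) (map (digit radix x) [0..<i]))" for x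
      by (rule slope_cong) simp
    moreover have "(\<lambda>u. slope \<xi> i ((!) u)) \<in> count_space UNIV \<rightarrow>\<^sub>M borel" by simp
    ultimately show ?thesis
      using measurable_compose[OF measurable_digit_prefix[of radix i], of "\<lambda>u. slope \<xi> i ((!) u)" borel] by simp
  qed
  note [measurable] = this
  have [measurable]: "(\<lambda>x. real (digit radix x i)) \<in> borel_measurable borel" for i
    unfolding digit_def by measurable
  show ?thesis unfolding code_value_def code_term_def[abs_def] by measurable
qed

text \<open>
  With \<open>N = level (Suc k)\<close>, the sums are covered by \<open>c ^ N * 2 powr (d N\<^sup>2)\<close> intervals of length
  about \<open>2 powr (N - N\<^sup>2)\<close> at every late stage \<open>k\<close> that uses the table. As \<open>s > d\<close>, the quadratic term
  in the exponent decides.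
\<close>

lemma hausdorff_measure_table_sums_layer:
  assumes "\<xi> \<notin> \<rat>" "0 \<le> d" "d < s" "distinct (map fst tab)"
  shows "hausdorff_measure s (table_sums \<xi> l tab + layer d j) = 0"
proof (rule hausdorff_measure_0_coverable)
  show "0 < s" using assms by simp
  fix e :: real assume "0 < e"
  define C where "C = (\<Sum>(u, m, n)\<leftarrow>tab. 2 * (\<bar>of_int m\<bar> + \<bar>of_int n - of_int m * \<xi>\<bar>))"
  define B where "B = C + 2 * real j + 1"
  define c where "c = 2 ^ length tab * (3 * (real j + 1))"
  have "0 \<le> C" unfolding C_def by (intro sum_list_nonneg) auto
  then have "0 < B" by (simp add: B_def)
  have "0 < c" by (simp add: c_def)
  let ?r = "\<lambda>N. B * 2 powr (real N - (real N)\<^sup>2)"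
  let ?n = "\<lambda>N. c powr real N * 2 powr (d * (real N)\<^sup>2)"
  have "?r \<longlonglongrightarrow> 0" using \<open>0 < B\<close> by real_asymp
  then have ev1: "\<forall>\<^sub>F N in sequentially. ?r N < e" by (rule order_tendstoD(2)) (rule \<open>0 < e\<close>)
  \<comment> \<open>Collecting the exponents exhibits the leading coefficient \<open>- (s - d)\<close>.\<close>
  have "?n N * (2 * ?r N) powr s
      = (2 * B) powr s * 2 powr (- (s - d) * (real N)\<^sup>2 + (log 2 c + s) * real N)" for N
  proof -
    have "c powr real N = (2 powr log 2 c) powr real N" using \<open>0 < c\<close> by simp
    also have "\<dots> = 2 powr (log 2 c * real N)" by (rule powr_powr)
    finally have c: "c powr real N = 2 powr (log 2 c * real N)" .
    have "(2 * ?r N) powr s = (2 * B) powr s * (2 powr (real N - (real N)\<^sup>2)) powr s"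
      using \<open>0 < B\<close> by (simp only: mult.assoc[symmetric]) (subst powr_mult, simp_all)
    also have "\<dots> = (2 * B) powr s * 2 powr ((real N - (real N)\<^sup>2) * s)" by (simp only: powr_powr)
    finally have r: "(2 * ?r N) powr s = (2 * B) powr s * 2 powr ((real N - (real N)\<^sup>2) * s)" .
    have "?n N * (2 * ?r N) powr s
        = (2 * B) powr s * (2 powr (log 2 c * real N) * 2 powr (d * (real N)\<^sup>2) * 2 powr ((real N - (real N)\<^sup>2) * s))"
      unfolding c r by (simp only: mult_ac)
    also have "\<dots> = (2 * B) powr s * 2 powr (- (s - d) * (real N)\<^sup>2 + (log 2 c + s) * real N)"
      unfolding powr_add[symmetric] by (simp add: algebra_simps)
    finally show ?thesis .
  qed
  moreover have "(\<lambda>N. K * 2 powr (- a * (real N)\<^sup>2 + b * real N)) \<longlonglongrightarrow> 0" if "0 < a" for K a b :: real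
    using that by real_asymp
  from this[of "s - d"] have "(\<lambda>N. (2 * B) powr s * 2 powr (- (s - d) * (real N)\<^sup>2 + (log 2 c + s) * real N)) \<longlonglongrightarrow> 0"
    using assms(3) by simp
  ultimately have "(\<lambda>N. ?n N * (2 * ?r N) powr s) \<longlonglongrightarrow> 0" by (simp only:)
  then have ev2: "\<forall>\<^sub>F N in sequentially. ?n N * (2 * ?r N) powr s < e"
    by (rule order_tendstoD(2)) (rule \<open>0 < e\<close>)
  obtain N0 where N0: "\<And>N. N \<ge> N0 \<Longrightarrow> ?r N < e \<and> ?n N * (2 * ?r N) powr s < e"
    using eventually_conj[OF ev1 ev2] unfolding eventually_sequentially by blast
  \<comment> \<open>From stage \<open>b\<close> on, none of the slopes of the table is too steep.\<close>
  define b where "b = (\<Sum>(u, m, n)\<in>set tab. \<bar>killing_slope \<xi> m n\<bar>)"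
  obtain k where k: "k \<ge> max (max l N0) (nat \<lceil>b\<rceil>)" "stage k = (l, tab)"
    using stage_infinitely_often by blast
  have slopes: "\<bar>killing_slope \<xi> m n\<bar> \<le> 2 ^ level k" if "(u, m, n) \<in> set tab" for u m n
  proof -
    have "\<bar>killing_slope \<xi> m n\<bar> \<le> b"
      unfolding b_def using member_le_sum[OF that, of "\<lambda>(u, m, n). \<bar>killing_slope \<xi> m n\<bar>"] by auto
    also have "b \<le> real k" using k by linarith
    also have "real k \<le> real (2 ^ level k)"
      by (intro of_nat_mono) (use le_level[of k] less_exp[of "level k"] in linarith)
    finally show ?thesis by simp
  qed
  define N where "N = level (Suc k)"
  have kN: "(level k)\<^sup>2 \<le> N" by (simp add: N_def)
  have "k < N" using le_level[of "Suc k"] by (simp only: N_def)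
  have "coverable ((2 ^ (level k)\<^sup>2) ^ length tab) (C / 2 ^ gap (Suc k)) (table_sums \<xi> l tab)"
    unfolding C_def using k slopes assms by (intro coverable_table_sums) auto
  then have "coverable ((2 ^ (level k)\<^sup>2) ^ length tab * ((3 * (real j + 1)) ^ N * 2 powr (d * real (N\<^sup>2))))
     (C / 2 ^ gap (Suc k) + 2 * real j / 2 ^ N\<^sup>2) (table_sums \<xi> l tab + layer d j)"
    using assms by (intro coverable_plus coverable_layer) auto
  moreover have "(2 ^ (level k)\<^sup>2) ^ length tab * ((3 * (real j + 1)) ^ N * 2 powr (d * real (N\<^sup>2))) \<le> ?n N"
  proof -
    have "((2::real) ^ (level k)\<^sup>2) ^ length tab \<le> (2 ^ N) ^ length tab"
      using kN by (intro power_mono power_increasing) auto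
    also have "\<dots> = (2 ^ length tab) ^ N" by (simp only: power_mult[symmetric] mult.commute)
    finally have "(2 ^ (level k)\<^sup>2) ^ length tab * ((3 * (real j + 1)) ^ N * 2 powr (d * real (N\<^sup>2)))
        \<le> (2 ^ length tab) ^ N * ((3 * (real j + 1)) ^ N * 2 powr (d * real (N\<^sup>2)))"
      by (intro mult_right_mono) auto
    also have "\<dots> = c ^ N * 2 powr (d * real (N\<^sup>2))"
      unfolding c_def by (simp only: power_mult_distrib mult.assoc)
    also have "\<dots> = ?n N" using \<open>0 < c\<close> by (simp add: powr_realpow)
    finally show ?thesis .
  qed
  moreover have "C / 2 ^ gap (Suc k) + 2 * real j / 2 ^ N\<^sup>2 \<le> ?r N"
  proof -
    have g: "(2::real) ^ N\<^sup>2 = 2 ^ N * 2 ^ gap (Suc k)"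
      unfolding N_def level_power2[of "Suc k"] by (rule power_add)
    have "2 * real j / 2 ^ N\<^sup>2 \<le> 2 * real j / 2 ^ gap (Suc k)"
      unfolding g by (intro divide_left_mono) auto
    then have "C / 2 ^ gap (Suc k) + 2 * real j / 2 ^ N\<^sup>2 \<le> (C + 2 * real j) / 2 ^ gap (Suc k)"
      by (simp add: add_divide_distrib)
    also have "\<dots> \<le> B / 2 ^ gap (Suc k)" unfolding B_def by (intro divide_right_mono) auto
    also have "\<dots> = B * (2 ^ N / 2 ^ N\<^sup>2)" unfolding g by simp
    also have "2 ^ N / 2 ^ N\<^sup>2 = 2 powr (real N - (real N)\<^sup>2)"
      by (simp add: powr_diff powr_realpow[symmetric])
    finally show ?thesis .
  qed
  ultimately have "coverable (?n N) (?r N) (table_sums \<xi> l tab + layer d j)" by (rule coverable_mono)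
  then show "\<exists>N r. coverable N r (table_sums \<xi> l tab + layer d j) \<and> 0 \<le> r \<and> r \<le> e \<and> N * (2 * r) powr s \<le> e"
    using N0[of N] \<open>k < N\<close> k \<open>0 < B\<close> by (intro exI[of _ "?n N"] exI[of _ "?r N"]) auto
qed

definition witness_group :: "real \<Rightarrow> real \<Rightarrow> real set" where
  "witness_group \<xi> d = (\<Union>L. combinations \<xi> L) + (\<Union>j. layer d j)"

lemma witness_group_eq_Union: "witness_group \<xi> d = (\<Union>(L, j). combinations \<xi> L + layer d j)"
  by (auto simp: witness_group_def set_plus_def)

lemma fsigma_witness_group: "fsigma_in euclidean (witness_group \<xi> d)"
  unfolding witness_group_eq_Union
proof (intro fsigma_in_Union)
  fix S assume "S \<in> range (\<lambda>(L, j). combinations \<xi> L + layer d j)"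
  then obtain L j where S: "S = combinations \<xi> L + layer d j" by auto
  also have "\<dots> = (\<Union>x\<in>combinations \<xi> L. \<Union>y\<in>layer d j. {x + y})" by (auto simp: set_plus_def)
  also have "closed \<dots>" by (rule compact_closed_sums) (rule compact_combinations closed_layer)+
  finally show "fsigma_in euclidean S" by (simp add: closed_imp_fsigma_in)
qed simp

lemma witness_group_add:
  assumes "x \<in> witness_group \<xi> d" "y \<in> witness_group \<xi> d"
  shows "x + y \<in> witness_group \<xi> d"
proof -
  obtain L j a b L' j' a' b' where *: "a \<in> combinations \<xi> L" "b \<in> layer d j" "x = a + b"
    "a' \<in> combinations \<xi> L'" "b' \<in> layer d j'" "y = a' + b'"
    using assms by (auto simp: witness_group_def set_plus_def)
  have "a + a' \<in> combinations \<xi> (L @ L')" unfolding combinations_append using * by (intro set_plus_intro)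
  moreover have "b + b' \<in> layer d (j + j')" using * by (intro add_in_layer)
  ultimately have "(a + a') + (b + b') \<in> witness_group \<xi> d"
    unfolding witness_group_def by (intro set_plus_intro) blast+
  then show ?thesis using * by (simp add: algebra_simps)
qed

lemma witness_group_uminus:
  assumes "x \<in> witness_group \<xi> d"
  shows "- x \<in> witness_group \<xi> d"
proof -
  obtain L j a b where *: "a \<in> combinations \<xi> L" "b \<in> layer d j" "x = a + b"
    using assms by (auto simp: witness_group_def set_plus_def)
  have "(- a) + (- b) \<in> witness_group \<xi> d"
    unfolding witness_group_def using uminus_combinations[OF *(1)] uminus_in_layer[OF *(2)]
    by (intro set_plus_intro) blast+
  then show ?thesis using * by (simp add: algebra_simps)
qed

lemma combinations_subset_witness_group: "combinations \<xi> L \<subseteq> witness_group \<xi> d"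
proof
  fix x assume "x \<in> combinations \<xi> L"
  then have "x + 0 \<in> witness_group \<xi> d"
    unfolding witness_group_def using zero_in_layer[of d 0] by (intro set_plus_intro) blast+
  then show "x \<in> witness_group \<xi> d" by simp
qed

lemma layer_subset_witness_group: "layer d j \<subseteq> witness_group \<xi> d"
proof
  fix x assume "x \<in> layer d j"
  moreover have "0 \<in> (\<Union>L. combinations \<xi> L)" using UN_I[of "[]" UNIV 0 "combinations \<xi>"] by simp
  ultimately have "0 + x \<in> witness_group \<xi> d"
    unfolding witness_group_def by (intro set_plus_intro) blast+
  then show "x \<in> witness_group \<xi> d" by simp
qed

lemma subgroup_witness_group: "subgroup (witness_group \<xi> d) real_add_group"
proof
  fix x assume x: "x \<in> witness_group \<xi> d"
  have "inv\<^bsub>real_add_group\<^esub> x = - x"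
    by (rule group.inv_equality[OF group_real_add_group]) auto
  then show "inv\<^bsub>real_add_group\<^esub> x \<in> witness_group \<xi> d" using witness_group_uminus[OF x] by simp
next
  show "\<one>\<^bsub>real_add_group\<^esub> \<in> witness_group \<xi> d"
    using subsetD[OF layer_subset_witness_group zero_in_layer] by simp
qed (auto intro: witness_group_add)

lemma hausdorff_dim_witness_group:
  assumes "\<xi> \<notin> \<rat>" "0 \<le> d" "d < 1"
  shows "hausdorff_dim (witness_group \<xi> d) = ennreal d"
proof (rule antisym)
  show "hausdorff_dim (witness_group \<xi> d) \<le> ennreal d"
  proof (rule hausdorff_dim_le[OF assms(2)])
    fix s assume "d < s"
    let ?I = "{(l, tab, j). distinct (map fst tab)} :: (nat \<times> (nat list \<times> int \<times> int) list \<times> nat) set"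
    let ?A = "\<lambda>(l, tab, j). table_sums \<xi> l tab + layer d j"
    have "hausdorff_measure s (\<Union>i\<in>?I. ?A i) = 0"
      by (rule hausdorff_measure_0_countable_Union)
        (auto intro: hausdorff_measure_table_sums_layer[OF assms(1,2) \<open>d < s\<close>])
    moreover have "witness_group \<xi> d \<subseteq> (\<Union>i\<in>?I. ?A i)"
    proof
      fix x assume "x \<in> witness_group \<xi> d"
      then obtain L j a b where *: "a \<in> combinations \<xi> L" "b \<in> layer d j" "x = a + b"
        by (auto simp: witness_group_def set_plus_def)
      obtain l tab where "distinct (map fst tab)" "a \<in> table_sums \<xi> l tab"
        using combinations_subset_table_sums[OF *(1)] by blast
      then show "x \<in> (\<Union>i\<in>?I. ?A i)"
        using * by (intro UN_I[of "(l, tab, j)"]) (auto intro: set_plus_intro)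
    qed
    ultimately show "hausdorff_measure s (witness_group \<xi> d) = 0"
      using hausdorff_measure_mono by (metis le_zero_eq)
  qed
  show "ennreal d \<le> hausdorff_dim (witness_group \<xi> d)"
  proof (cases "d = 0")
    case False
    show ?thesis
    proof (rule hausdorff_dim_ge)
      fix t assume "t < d"
      define s where "s = max t 0"
      have "0 \<le> s" "s < d" using \<open>t < d\<close> False assms by (auto simp: s_def)
      then have "hausdorff_measure s (layer d 1) \<noteq> 0" using assms by (intro hausdorff_measure_layer_pos)
      then have "hausdorff_measure s (witness_group \<xi> d) \<noteq> 0"
        using hausdorff_measure_mono[OF layer_subset_witness_group[of d 1 \<xi>], of s] by auto
      moreover have "t \<le> s" by (simp add: s_def)
      ultimately show "\<exists>s\<ge>t. hausdorff_measure s (witness_group \<xi> d) \<noteq> 0" by blast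
    qed
  qed simp
qed

text \<open>
  These are the numbers \<open>a(x) + \<eta> b(x)\<close>.
\<close>

lemma pencil_subset:
  assumes "x \<in> {0..<1}"
  shows "x + (\<eta> - \<xi>) * code_value \<xi> 0 1 (digit radix x) \<in> witness_group \<xi> d + \<eta> *o witness_group \<xi> d"
proof -
  let ?\<omega> = "digit radix x"
  have w: "?\<omega> \<in> codes" by (rule codes_represent[OF assms])
  have "code_value \<xi> 1 (- \<xi>) ?\<omega> \<in> combinations \<xi> [(1, 0)]" "code_value \<xi> 0 1 ?\<omega> \<in> combinations \<xi> [(0, 1)]"
    using w by (auto simp: combination_def set_plus_def)
  then have mem: "code_value \<xi> 1 (- \<xi>) ?\<omega> \<in> witness_group \<xi> d" "code_value \<xi> 0 1 ?\<omega> \<in> witness_group \<xi> d"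
    using combinations_subset_witness_group by blast+
  have "code_value \<xi> 1 (- \<xi>) ?\<omega> = x - \<xi> * code_value \<xi> 0 1 ?\<omega>"
    using code_value_linear[OF w, of \<xi> 1 "- \<xi>" 0 0 1] codes_represent(2)[OF assms, of \<xi>] by simp
  then have "x + (\<eta> - \<xi>) * code_value \<xi> 0 1 ?\<omega> = code_value \<xi> 1 (- \<xi>) ?\<omega> + \<eta> * code_value \<xi> 0 1 ?\<omega>"
    by (simp add: algebra_simps)
  then show ?thesis using mem by (auto simp: elt_set_times_def intro!: set_plus_intro)
qed

text \<open>
  For \<open>\<eta> = \<xi>\<close> the numbers \<open>a(x) + \<eta> b(x) = x\<close> fill \<open>[0, 1)\<close>, and no proper subgroup of \<open>\<real>\<close> contains this interval.
\<close>

lemma witness_group_plus_multiple: "witness_group \<xi> d + \<xi> *o witness_group \<xi> d = UNIV"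
proof -
  let ?G = "witness_group \<xi> d + \<xi> *o witness_group \<xi> d"
  have G: "x \<in> ?G \<longleftrightarrow> (\<exists>a\<in>witness_group \<xi> d. \<exists>b\<in>witness_group \<xi> d. x = a + \<xi> * b)" for x
    by (auto simp: elt_set_times_def set_plus_def)
  have add: "x + y \<in> ?G" if xy: "x \<in> ?G" "y \<in> ?G" for x y
  proof -
    obtain a b a' b' where "a \<in> witness_group \<xi> d" "b \<in> witness_group \<xi> d" "x = a + \<xi> * b"
      "a' \<in> witness_group \<xi> d" "b' \<in> witness_group \<xi> d" "y = a' + \<xi> * b'"
      using xy unfolding G by blast
    then show ?thesis unfolding G
      by (intro bexI[of _ "a + a'"] bexI[of _ "b + b'"]) (auto intro: witness_group_add simp: algebra_simps)
  qed
  have minus: "- x \<in> ?G" if x: "x \<in> ?G" for x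
  proof -
    obtain a b where "a \<in> witness_group \<xi> d" "b \<in> witness_group \<xi> d" "x = a + \<xi> * b"
      using x unfolding G by blast
    then show ?thesis unfolding G
      by (intro bexI[of _ "- a"] bexI[of _ "- b"]) (auto intro: witness_group_uminus simp: algebra_simps)
  qed
  have unit: "x \<in> ?G" if "x \<in> {0..<1}" for x
    using pencil_subset[OF that, of \<xi> \<xi> d] by simp
  have mult: "real n * x \<in> ?G" if "x \<in> {0..<1}" for n x
    by (induction n) (use unit[of 0] unit[OF that] add in \<open>auto simp: distrib_right\<close>)
  have "y \<in> ?G" for y
  proof -
    define n where "n = Suc (nat \<lceil>\<bar>y\<bar>\<rceil>)"
    have "\<bar>y\<bar> < real n" unfolding n_def by linarith
    then have "\<bar>y\<bar> / real n \<in> {0..<1}" by (auto simp: n_def)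
    then have "real n * (\<bar>y\<bar> / real n) \<in> ?G" by (rule mult)
    moreover have "n \<noteq> 0" by (simp add: n_def)
    ultimately have "\<bar>y\<bar> \<in> ?G" by simp
    then show ?thesis using minus[of "\<bar>y\<bar>"] by (cases "0 \<le> y") auto
  qed
  then show ?thesis by blast
qed

lemma AE_hausdorff_dim_witness_group_plus_multiple:
  "AE \<eta> in lebesgue. hausdorff_dim (witness_group \<xi> d + \<eta> *o witness_group \<xi> d) = 1"
proof (rule AE_completion)
  let ?f = "\<lambda>\<eta> x. x + (\<eta> - \<xi>) * code_value \<xi> 0 1 (digit radix x)"
  let ?s = "\<lambda>n. 1 - 1 / (real n + 2)"
  have "AE \<eta> in lborel. \<forall>n. hausdorff_measure (?s n) (?f \<eta> ` {0..<1}) \<noteq> 0"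
    unfolding AE_all_countable
    by (intro allI AE_hausdorff_measure_pencil_pos measurable_code_value_digit) auto
  then show "AE \<eta> in lborel. hausdorff_dim (witness_group \<xi> d + \<eta> *o witness_group \<xi> d) = 1"
  proof eventually_elim
    case (elim \<eta>)
    let ?G = "witness_group \<xi> d + \<eta> *o witness_group \<xi> d"
    have "ennreal 1 \<le> hausdorff_dim ?G"
    proof (rule hausdorff_dim_ge)
      fix t :: real assume "t < 1"
      obtain n :: nat where "1 / (1 - t) < real n" using reals_Archimedean2 by blast
      then have "1 < (real n + 2) * (1 - t)" using \<open>t < 1\<close> by (simp add: pos_divide_less_eq distrib_right)
      then have "1 / (real n + 2) \<le> 1 - t" by (simp add: pos_divide_le_eq mult.commute)
      then have "t \<le> ?s n" by simp
      moreover have "?f \<eta> ` {0..<1} \<subseteq> ?G" using pencil_subset by blast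
      then have "hausdorff_measure (?s n) (?f \<eta> ` {0..<1}) \<le> hausdorff_measure (?s n) ?G"
        by (rule hausdorff_measure_mono)
      then have "hausdorff_measure (?s n) ?G \<noteq> 0" using elim[rule_format, of n] by (metis le_zero_eq)
      ultimately show "\<exists>s\<ge>t. hausdorff_measure s ?G \<noteq> 0" by blast
    qed
    then have "1 \<le> hausdorff_dim ?G" by simp
    then show ?case by (rule antisym[OF hausdorff_dim_real_le_1])
  qed
qed

theorem corollary4p5:
  fixes d \<xi>\<^sub>0 :: real
  assumes "0 \<le> d" and "d < 1"
    and "\<xi>\<^sub>0 \<notin> \<rat>"
  shows "\<exists>A :: real set.
           fsigma_in euclidean A \<and>
           subgroup A real_add_group \<and>
           hausdorff_dim A = ennreal d \<and>
           A + \<xi>\<^sub>0 *o A = UNIV \<and>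
           (AE \<xi> in lebesgue. hausdorff_dim (A + \<xi> *o A) = 1)"
  by (intro exI[of _ "witness_group \<xi>\<^sub>0 d"] conjI fsigma_witness_group subgroup_witness_group
      hausdorff_dim_witness_group witness_group_plus_multiple
      AE_hausdorff_dim_witness_group_plus_multiple assms)


end
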